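(* Let $X\subseteq\mathbb{R}^N$ be a geodesic subspace with positive convexity radius $\rho$ and finite distortion $\delta$. Let $S$ be a finite subset of $\mathbb{R}^N$, and let $\varepsilon$ be a positive number such that $$d_H(X,S)<\frac{\varepsilon}{4}<\frac{\rho}{2\delta(3\delta+2)}.$$ Then, for every non-negative integer $k$, there is an isomorphism $$H_k(X)\cong \operatorname{im}\Bigl(j_\ast:H_k(\mathcal{R}_\varepsilon(S))\to H_k\bigl(\mathcal{R}_{\frac{1}{2}(3\delta+1)\varepsilon}(S)\bigr)\Bigr),$$ where $j_\ast$ is induced by the simplicial inclusion $j:\mathcal{R}_\varepsilon(S)\hookrightarrow\mathcal{R}_{\frac{1}{2}(3\delta+1)\varepsilon}(S)$.
   Context: $\|\cdot\|_2$ is the Euclidean norm on $\mathbb{R}^N$, and $d_H$ is the Hausdorff distance between subsets of $\mathbb{R}^N$ with respect to the Euclidean metric. The length $L(\gamma)$ of a continuous path $\gamma:[0,1]\to\mathbb{R}^N$ is the supremum, over finite discretizations $0=t_0<t_1<\dots<t_k=1$, of $\sum_i\|\gamma(t_i)-\gamma(t_{i+1})\|_2$; $\gamma$ is rectifiable if $L(\gamma)<\infty$. For path-connected $X\subseteq\mathbb{R}^N$, the induced length metric is $d_L(x,y)=\inf L(\gamma)$ over continuous paths $\gamma:[0,1]\to X$ from $x$ to $y$. $X$ is a geodesic subspace if any $x,y\in X$ are joined by a rectifiable path in $X$ of length $d_L(x,y)$. The distortion of $X$ is $\delta=\sup_{x\ne y\in X} d_L(x,y)/\|x-y\|_2$.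 If $\delta<\infty$, the topologies on $X$ induced by $d_L$ and by the Euclidean metric coincide. The convexity radius $\rho$ of $X$ is the supremum of all $r>0$ such that: (i) for all $x,y\in X$ with $d_L(x,y)<2r$ there is a unique length-minimizing geodesic path joining $x$ and $y$; (ii) if $x,y,z,u\in X$ satisfy $d_L(x,y)<r$, $d_L(y,z)<r$, $d_L(z,x)<r$ and $u$ is a point on the length-minimizing geodesic path joining $x$ and $y$, then $d_L(u,z)\le\max\{d_L(x,z),d_L(y,z)\}$; (iii) if $\gamma,\gamma'$ are arc-length parametrized length-minimizing geodesics on $X$ with $\gamma(0)=\gamma'(0)$, then $d_L(\gamma(ts),\gamma'(ts'))\le d_L(\gamma(s),\gamma'(s'))$ for $0\le s,s'<r$ and $0\le t\le1$. For $A\subseteq\mathbb{R}^N$ and $\alpha>0$, the Euclidean Vietoris-Rips complex $\mathcal{R}_\alpha(A)$ is the abstract simplicial complex whose simplices are the finite non-empty subsets of $A$ of Euclidean diameter at most $\alpha$. $H_k$ denotes ordinary (integer) homology. *)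

theory Defs
  imports "HOL-Analysis.Analysis" "HOL-Homology.Homology"
begin

section \<open>Hausdorff distance\<close>

definition hausdorff_distance :: "'a::metric_space set \<Rightarrow> 'a set \<Rightarrow> ennreal" where
  "hausdorff_distance A B =
     max (SUP x\<in>A. INF y\<in>B. ennreal (dist x y)) (SUP y\<in>B. INF x\<in>A. ennreal (dist x y))"

section \<open>Length of curves and the induced length metric\<close>

definition curve_length :: "(real \<Rightarrow> 'a::metric_space) \<Rightarrow> real \<Rightarrow> real \<Rightarrow> ennreal" where
  "curve_length \<gamma> a b =
     Sup {ennreal (\<Sum>i<k. dist (\<gamma> (t i)) (\<gamma> (t (Suc i)))) | (k :: nat) (t :: nat \<Rightarrow> real).
            t 0 = a \<and> t k = b \<and> (\<forall>i<k. t i < t (Suc i))}"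

definition joining_path :: "'a::metric_space set \<Rightarrow> 'a \<Rightarrow> 'a \<Rightarrow> (real \<Rightarrow> 'a) \<Rightarrow> bool" where
  "joining_path X x y \<gamma> \<longleftrightarrow>
     path \<gamma> \<and> path_image \<gamma> \<subseteq> X \<and> pathstart \<gamma> = x \<and> pathfinish \<gamma> = y"

definition length_dist :: "'a::metric_space set \<Rightarrow> 'a \<Rightarrow> 'a \<Rightarrow> ennreal" where
  "length_dist X x y = (INF \<gamma>\<in>{\<gamma>. joining_path X x y \<gamma>}. curve_length \<gamma> 0 1)"

definition geodesic_subspace :: "'a::metric_space set \<Rightarrow> bool" where
  "geodesic_subspace X \<longleftrightarrow>
     (\<forall>x\<in>X. \<forall>y\<in>X. \<exists>\<gamma>. joining_path X x y \<gamma> \<and>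
        curve_length \<gamma> 0 1 < \<infinity> \<and> curve_length \<gamma> 0 1 = length_dist X x y)"

definition distortion :: "'a::metric_space set \<Rightarrow> ennreal" where
  "distortion X =
     (SUP (x, y)\<in>{(x, y). x \<in> X \<and> y \<in> X \<and> x \<noteq> y}. length_dist X x y / ennreal (dist x y))"

section \<open>Convexity radius\<close>

text \<open>
  Length-minimizing geodesic paths are represented by their arc-length parametrization on
  \<open>{0..l}\<close>, where \<open>l\<close> is their length.  In this way uniqueness of a geodesic path joining two
  points means uniqueness up to reparametrization.
\<close>

definition minimizing_geodesic :: "'a::metric_space set \<Rightarrow> real \<Rightarrow> (real \<Rightarrow> 'a) \<Rightarrow> bool" where
  "minimizing_geodesic X l \<gamma> \<longleftrightarrow>
     0 \<le> l \<and> continuous_on {0..l} \<gamma> \<and> \<gamma> ` {0..l} \<subseteq> X \<and>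
     (\<forall>s\<in>{0..l}. curve_length \<gamma> 0 s = ennreal s) \<and>
     curve_length \<gamma> 0 l = length_dist X (\<gamma> 0) (\<gamma> l)"

definition joining_geodesic ::
    "'a::metric_space set \<Rightarrow> 'a \<Rightarrow> 'a \<Rightarrow> real \<Rightarrow> (real \<Rightarrow> 'a) \<Rightarrow> bool" where
  "joining_geodesic X x y l \<gamma> \<longleftrightarrow> minimizing_geodesic X l \<gamma> \<and> \<gamma> 0 = x \<and> \<gamma> l = y"

definition unique_geodesics_within :: "'a::metric_space set \<Rightarrow> real \<Rightarrow> bool" where
  "unique_geodesics_within X r \<longleftrightarrow>
     (\<forall>x\<in>X. \<forall>y\<in>X. length_dist X x y < ennreal (2 * r) \<longrightarrow>
        (\<exists>l \<gamma>. joining_geodesic X x y l \<gamma> \<and>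
           (\<forall>l' \<gamma>'. joining_geodesic X x y l' \<gamma>' \<longrightarrow> l' = l \<and> (\<forall>s\<in>{0..l}. \<gamma>' s = \<gamma> s))))"

definition convex_distances_within :: "'a::metric_space set \<Rightarrow> real \<Rightarrow> bool" where
  "convex_distances_within X r \<longleftrightarrow>
     (\<forall>x\<in>X. \<forall>y\<in>X. \<forall>z\<in>X. \<forall>u\<in>X.
        length_dist X x y < ennreal r \<longrightarrow> length_dist X y z < ennreal r \<longrightarrow>
        length_dist X z x < ennreal r \<longrightarrow>
        (\<exists>l \<gamma>. joining_geodesic X x y l \<gamma> \<and> u \<in> \<gamma> ` {0..l}) \<longrightarrow>
        length_dist X u z \<le> max (length_dist X x z) (length_dist X y z))"

definition contracting_geodesics_within :: "'a::metric_space set \<Rightarrow> real \<Rightarrow> bool" where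
  "contracting_geodesics_within X r \<longleftrightarrow>
     (\<forall>l l' \<gamma> \<gamma>'. minimizing_geodesic X l \<gamma> \<longrightarrow> minimizing_geodesic X l' \<gamma>' \<longrightarrow> \<gamma> 0 = \<gamma>' 0 \<longrightarrow>
        (\<forall>s\<in>{0..l}. \<forall>s'\<in>{0..l'}. \<forall>t\<in>{0..1}. s < r \<longrightarrow> s' < r \<longrightarrow>
           length_dist X (\<gamma> (t * s)) (\<gamma>' (t * s')) \<le> length_dist X (\<gamma> s) (\<gamma>' s')))"

definition convexity_radius :: "'a::metric_space set \<Rightarrow> ennreal" where
  "convexity_radius X =
     Sup {ennreal r | r. 0 < r \<and> unique_geodesics_within X r \<and>
                          convex_distances_within X r \<and> contracting_geodesics_within X r}"

section \<open>Vietoris-Rips complexes and their geometric realizations\<close>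

text \<open>An abstract simplicial complex is given by its set of simplices.\<close>

definition abstract_simplicial_complex :: "'v set set \<Rightarrow> bool" where
  "abstract_simplicial_complex K \<longleftrightarrow>
     (\<forall>\<sigma>\<in>K. finite \<sigma> \<and> \<sigma> \<noteq> {}) \<and> (\<forall>\<sigma>\<in>K. \<forall>\<tau>. \<tau> \<noteq> {} \<and> \<tau> \<subseteq> \<sigma> \<longrightarrow> \<tau> \<in> K)"

definition rips_complex :: "real \<Rightarrow> 'a::metric_space set \<Rightarrow> 'a set set" where
  "rips_complex \<alpha> A = {\<sigma>. finite \<sigma> \<and> \<sigma> \<noteq> {} \<and> \<sigma> \<subseteq> A \<and> diameter \<sigma> \<le> \<alpha>}"

lemma abstract_simplicial_complex_rips: "abstract_simplicial_complex (rips_complex \<alpha> A)"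
  unfolding abstract_simplicial_complex_def
proof (intro conjI ballI allI impI)
  fix \<sigma> \<tau> assume \<sigma>: "\<sigma> \<in> rips_complex \<alpha> A" and \<tau>: "\<tau> \<noteq> {} \<and> \<tau> \<subseteq> \<sigma>"
  then have "diameter \<tau> \<le> diameter \<sigma>"
    by (intro diameter_subset finite_imp_bounded) (simp_all add: rips_complex_def)
  with \<sigma> \<tau> show "\<tau> \<in> rips_complex \<alpha> A"
    by (auto simp: rips_complex_def intro: finite_subset)
qed (simp_all add: rips_complex_def)

text \<open>A point of the geometric realization is a vector of barycentric coordinates.\<close>

definition closed_simplex :: "'v set \<Rightarrow> ('v \<Rightarrow> real) set" where
  "closed_simplex \<sigma> =
     {p. (\<forall>v. 0 \<le> p v) \<and> (\<forall>v. v \<notin> \<sigma> \<longrightarrow> p v = 0) \<and> (\<Sum>v\<in>\<sigma>. p v) = 1}"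

text \<open>
  The realization carries the weak topology: a set is open iff its trace on each closed simplex is
  open.  The topology of a closed simplex is that of coordinatewise convergence.
\<close>

definition realization :: "'v set set \<Rightarrow> ('v \<Rightarrow> real) topology" where
  "realization K = topology (\<lambda>U. U \<subseteq> (\<Union>\<sigma>\<in>K. closed_simplex \<sigma>) \<and>
     (\<forall>\<sigma>\<in>K. openin (top_of_set (closed_simplex \<sigma>)) (U \<inter> closed_simplex \<sigma>)))"

lemma openin_realization:
  "openin (realization K) U \<longleftrightarrow> U \<subseteq> (\<Union>\<sigma>\<in>K. closed_simplex \<sigma>) \<and>
     (\<forall>\<sigma>\<in>K. openin (top_of_set (closed_simplex \<sigma>)) (U \<inter> closed_simplex \<sigma>))"
proof -
  define op where "op = (\<lambda>U. U \<subseteq> (\<Union>\<sigma>\<in>K. closed_simplex \<sigma>) \<and>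
     (\<forall>\<sigma>\<in>K. openin (top_of_set (closed_simplex \<sigma>)) (U \<inter> closed_simplex \<sigma>)))"
  have Int: "op (S \<inter> T)" if S: "op S" and T: "op T" for S T
    unfolding op_def
  proof (intro conjI ballI)
    show "S \<inter> T \<subseteq> (\<Union>\<sigma>\<in>K. closed_simplex \<sigma>)"
      using S unfolding op_def by (rule le_infI1[OF conjunct1])
    fix \<sigma> assume "\<sigma> \<in> K"
    then have "openin (top_of_set (closed_simplex \<sigma>))
        ((S \<inter> closed_simplex \<sigma>) \<inter> (T \<inter> closed_simplex \<sigma>))"
      using S T by - (rule openin_Int; simp add: op_def)
    moreover have "S \<inter> T \<inter> closed_simplex \<sigma> = (S \<inter> closed_simplex \<sigma>) \<inter> (T \<inter> closed_simplex \<sigma>)"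
      by blast
    ultimately show "openin (top_of_set (closed_simplex \<sigma>)) (S \<inter> T \<inter> closed_simplex \<sigma>)"
      by (simp only:)
  qed
  have Un: "op (\<Union>\<U>)" if \<U>: "\<forall>U\<in>\<U>. op U" for \<U>
    unfolding op_def
  proof (intro conjI ballI)
    show "\<Union>\<U> \<subseteq> (\<Union>\<sigma>\<in>K. closed_simplex \<sigma>)"
      by (rule Union_least) (use \<U> in \<open>simp add: op_def\<close>)
    fix \<sigma> assume \<sigma>: "\<sigma> \<in> K"
    have "openin (top_of_set (closed_simplex \<sigma>)) (\<Union>U\<in>\<U>. U \<inter> closed_simplex \<sigma>)"
    proof (rule openin_Union)
      fix V assume "V \<in> (\<lambda>U. U \<inter> closed_simplex \<sigma>) ` \<U>"
      then obtain U where "U \<in> \<U>" "V = U \<inter> closed_simplex \<sigma>"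
        by (rule imageE)
      with \<U> \<sigma> show "openin (top_of_set (closed_simplex \<sigma>)) V"
        by (simp add: op_def)
    qed
    then show "openin (top_of_set (closed_simplex \<sigma>)) (\<Union>\<U> \<inter> closed_simplex \<sigma>)"
      by (simp only: Int_Union2)
  qed
  have "istopology op"
    unfolding istopology_def using Int Un by simp
  then have "openin (realization K) = op"
    unfolding realization_def op_def[symmetric] by (rule topology_inverse')
  then show ?thesis
    by (simp add: op_def)
qed

lemma topspace_realization: "topspace (realization K) = (\<Union>\<sigma>\<in>K. closed_simplex \<sigma>)"
proof (rule subset_antisym)
  show "topspace (realization K) \<subseteq> (\<Union>\<sigma>\<in>K. closed_simplex \<sigma>)"
    using openin_realization[THEN iffD1, OF openin_topspace] by (rule conjunct1)
  have "openin (realization K) (\<Union>\<sigma>\<in>K. closed_simplex \<sigma>)"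
    unfolding openin_realization
  proof (intro conjI ballI)
    fix \<sigma> assume "\<sigma> \<in> K"
    then have "(\<Union>\<sigma>\<in>K. closed_simplex \<sigma>) \<inter> closed_simplex \<sigma> = closed_simplex \<sigma>"
      by blast
    then show "openin (top_of_set (closed_simplex \<sigma>)) ((\<Union>\<sigma>\<in>K. closed_simplex \<sigma>) \<inter> closed_simplex \<sigma>)"
      by (simp only: openin_subtopology_self)
  qed (rule subset_refl)
  then show "(\<Union>\<sigma>\<in>K. closed_simplex \<sigma>) \<subseteq> topspace (realization K)"
    by (rule openin_subset)
qed

text \<open>The map of realizations induced by a vertex map \<open>f\<close>: affine extension over each simplex.\<close>

definition realization_map :: "('v \<Rightarrow> 'w) \<Rightarrow> ('v \<Rightarrow> real) \<Rightarrow> ('w \<Rightarrow> real)" where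
  "realization_map f p = (\<lambda>w. \<Sum>v | p v \<noteq> 0 \<and> f v = w. p v)"

text \<open>The homology of a simplicial complex is the singular homology of its realization.\<close>

definition complex_homology :: "nat \<Rightarrow> 'v set set \<Rightarrow> ('v \<Rightarrow> real) chain set monoid" where
  "complex_homology k K = homology_group (int k) (realization K)"

definition complex_hom_induced ::
    "nat \<Rightarrow> 'v set set \<Rightarrow> 'w set set \<Rightarrow> ('v \<Rightarrow> 'w) \<Rightarrow>
     ('v \<Rightarrow> real) chain set \<Rightarrow> ('w \<Rightarrow> real) chain set" where
  "complex_hom_induced k K L f =
     hom_induced (int k) (realization K) {} (realization L) {} (realization_map f)"

definition hom_image :: "('a, 'm) monoid_scheme \<Rightarrow> ('b, 'n) monoid_scheme \<Rightarrow> ('a \<Rightarrow> 'b) \<Rightarrow>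
    ('b, 'n) monoid_scheme" where
  "hom_image G H h = H\<lparr>carrier := h ` carrier G\<rparr>"

end

theory Submission
  imports Defs
begin

text \<open>
  Let \<open>K\<close> and \<open>L\<close> be the realizations of the two complexes, \<open>j : K \<rightarrow> L\<close> the inclusion, and choose
  for each \<open>s \<in> S\<close> a point \<open>g s \<in> X\<close> at distance less than \<open>\<epsilon>/4\<close>.  A partition of unity subordinate to
  the balls of radius \<open>\<epsilon>/4\<close> around \<open>S\<close> is a map \<open>p : X \<rightarrow> K\<close>, and the geodesic simplices with
  vertices \<open>g s\<close> form a map \<open>q : L \<rightarrow> X\<close>, because these vertices are at length distance less than
  the convexity radius.  The map \<open>q \<circ> j \<circ> p\<close> moves each point by less than the convexity radius, so
  sliding along geodesics is a homotopy to the identity.  Convexity of distances keeps \<open>q\<close> of a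
  simplex \<open>\<sigma>\<close> of \<open>K\<close> within \<open>3\<delta>\<epsilon>/2\<close> of the points \<open>g s\<close> with \<open>s \<in> \<sigma>\<close>, hence \<open>\<sigma>\<close> and the carrier of
  \<open>p (q y)\<close>, for a point \<open>y\<close> of \<open>\<sigma>\<close>, span a simplex of \<open>L\<close>, and \<open>j \<circ> p \<circ> q \<circ> j\<close> is homotopic to \<open>j\<close>
  along straight lines.  Therefore \<open>j \<circ> p\<close> embeds the homology of \<open>X\<close> in that of \<open>L\<close>, with the same
  image as \<open>j\<close>.
\<close>

section \<open>Curve length and the length metric\<close>

lemma partition_mono:
  fixes t :: "nat \<Rightarrow> real"
  assumes "\<forall>i<k. t i < t (Suc i)" "i \<le> j" "j \<le> k"
  shows "t i \<le> t j"
  using assms(2,3)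
proof (induction j rule: dec_induct)
  case (step n)
  then show ?case using assms(1) by (metis Suc_le_lessD less_eq_real_def order.strict_trans1 less_imp_le)
qed simp

lemma curve_length_upper:
  assumes "t 0 = a" "t k = b" "\<forall>i<k. t i < t (Suc i)"
  shows "ennreal (\<Sum>i<k. dist (\<gamma> (t i)) (\<gamma> (t (Suc i)))) \<le> curve_length \<gamma> a b"
  unfolding curve_length_def by (rule Sup_upper) (use assms in blast)

lemma curve_length_least:
  assumes "\<And>k t. t 0 = a \<Longrightarrow> t k = b \<Longrightarrow> \<forall>i<k. t i < t (Suc i) \<Longrightarrow>
    ennreal (\<Sum>i<k. dist (\<gamma> (t i)) (\<gamma> (t (Suc i)))) \<le> B"
  shows "curve_length \<gamma> a b \<le> B"
  unfolding curve_length_def by (rule Sup_least) (use assms in blast)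

text \<open>A partition of \<open>{a..s}\<close> extends to one of \<open>{a..u}\<close> by the
  single point \<open>u\<close>, which adds the last chord. Partitions increase strictly, so
  \<open>s = u\<close> is treated apart.\<close>

lemma curve_length_append:
  assumes "a \<le> s" "s \<le> u"
  shows "curve_length \<gamma> a s + ennreal (dist (\<gamma> s) (\<gamma> u)) \<le> curve_length \<gamma> a u"
proof (cases "s = u")
  case False
  define c where "c = dist (\<gamma> s) (\<gamma> u)"
  have sum: "ennreal (\<Sum>i<k. dist (\<gamma> (t i)) (\<gamma> (t (Suc i)))) + ennreal c \<le> curve_length \<gamma> a u"
    if t: "t 0 = a" "t k = s" "\<forall>i<k. t i < t (Suc i)" for k t
  proof -
    define t' where "t' = (\<lambda>i. if i \<le> k then t i else u)"
    have "t' i < t' (Suc i)" if "i < Suc k" for i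
      using that t False assms by (cases "i = k") (auto simp: t'_def)
    then have "ennreal (\<Sum>i<Suc k. dist (\<gamma> (t' i)) (\<gamma> (t' (Suc i)))) \<le> curve_length \<gamma> a u"
      by (intro curve_length_upper) (use t in \<open>auto simp: t'_def\<close>)
    also have "(\<Sum>i<Suc k. dist (\<gamma> (t' i)) (\<gamma> (t' (Suc i)))) =
        (\<Sum>i<k. dist (\<gamma> (t i)) (\<gamma> (t (Suc i)))) + c"
      using t by (simp add: t'_def c_def)
    finally show ?thesis
      by (simp add: c_def sum_nonneg)
  qed
  have "curve_length \<gamma> a s \<le> curve_length \<gamma> a u - ennreal c"
  proof (rule curve_length_least)
    fix k t assume "t 0 = a" "t k = s" "\<forall>i<k. t i < t (Suc i)"
    from sum[OF this] show "ennreal (\<Sum>i<k. dist (\<gamma> (t i)) (\<gamma> (t (Suc i)))) \<le> curve_length \<gamma> a u - ennreal c"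
      by (simp add: ennreal_le_minus_iff)
  qed
  \<comment> \<open>Subtraction in \<open>ennreal\<close> is truncated at 0, so it can be undone
    only once \<open>ennreal c\<close> is known not to exceed the total. A single partition of
    \<open>{a..s}\<close> shows this; it has no steps if \<open>a = s\<close>.\<close>
  moreover have "ennreal c \<le> curve_length \<gamma> a u"
  proof -
    have "\<exists>k t. t 0 = a \<and> t k = s \<and> (\<forall>i<k. t i < t (Suc i))"
    proof (cases "a = s")
      case True
      then show ?thesis by (intro exI[of _ 0] exI[of _ "\<lambda>_. a"]) simp
    next
      case False
      then show ?thesis using assms
        by (intro exI[of _ 1] exI[of _ "\<lambda>i. if i = 0 then a else s"]) simp
    qed
    then obtain k t where "t 0 = a" "t k = s" "\<forall>i<k. t i < t (Suc i)" by blast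
    from sum[OF this] show ?thesis
      by (rule order_trans[rotated]) simp
  qed
  ultimately show ?thesis
    unfolding c_def[symmetric] ennreal_le_minus_iff by auto
qed simp

lemma dist_le_curve_length:
  assumes "a \<le> b"
  shows "ennreal (dist (\<gamma> a) (\<gamma> b)) \<le> curve_length \<gamma> a b"
  by (rule order_trans[OF _ curve_length_append[OF order_refl assms]]) simp

text \<open>Induction on the number of steps, looking at the last one. If it starts at or before
  \<open>c\<close>, the triangle inequality inserts \<open>\<gamma> c\<close>; otherwise the
  induction hypothesis splits the sum up to its start.\<close>

lemma curve_length_subadditive:
  assumes "a \<le> c" "c \<le> b"
  shows "curve_length \<gamma> a b \<le> curve_length \<gamma> a c + curve_length \<gamma> c b"
proof (rule curve_length_least)
  fix k and t :: "nat \<Rightarrow> real"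
  assume t: "t 0 = a" "t k = b" "\<forall>i<k. t i < t (Suc i)"
  show "ennreal (\<Sum>i<k. dist (\<gamma> (t i)) (\<gamma> (t (Suc i)))) \<le> curve_length \<gamma> a c + curve_length \<gamma> c b"
    using t assms
  proof (induction k arbitrary: b)
    case (Suc k)
    let ?S = "\<Sum>i<k. dist (\<gamma> (t i)) (\<gamma> (t (Suc i)))"
    have lt: "t k < b" and ak: "a \<le> t k"
      using Suc.prems partition_mono[of "Suc k" t 0 k] by auto
    have split: "ennreal (\<Sum>i<Suc k. dist (\<gamma> (t i)) (\<gamma> (t (Suc i)))) =
        ennreal ?S + ennreal (dist (\<gamma> (t k)) (\<gamma> b))"
      using Suc.prems by (simp add: sum_nonneg)
    show ?case
    proof (cases "t k \<le> c")
      case True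
      have "ennreal ?S + ennreal (dist (\<gamma> (t k)) (\<gamma> b)) \<le>
          curve_length \<gamma> a (t k) + ennreal (dist (\<gamma> (t k)) (\<gamma> c) + dist (\<gamma> c) (\<gamma> b))"
        using Suc.prems by (intro add_mono curve_length_upper ennreal_leI dist_triangle) auto
      also have "\<dots> = (curve_length \<gamma> a (t k) + ennreal (dist (\<gamma> (t k)) (\<gamma> c))) + ennreal (dist (\<gamma> c) (\<gamma> b))"
        by (simp add: add.assoc)
      also have "\<dots> \<le> curve_length \<gamma> a c + curve_length \<gamma> c b"
        using True ak Suc.prems by (intro add_mono curve_length_append dist_le_curve_length) auto
      finally show ?thesis by (simp only: split)
    next
      case False
      have "ennreal ?S + ennreal (dist (\<gamma> (t k)) (\<gamma> b)) \<le>
          (curve_length \<gamma> a c + curve_length \<gamma> c (t k)) + ennreal (dist (\<gamma> (t k)) (\<gamma> b))"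
        using Suc.prems False by (intro add_mono Suc.IH) auto
      also have "\<dots> \<le> curve_length \<gamma> a c + curve_length \<gamma> c b"
        unfolding add.assoc using False lt by (intro add_mono curve_length_append) auto
      finally show ?thesis by (simp only: split)
    qed
  qed simp
qed

lemma curve_length_affine_le:
  assumes "0 < c"
  shows "curve_length (\<lambda>s. \<gamma> (c * s + e)) a b \<le> curve_length \<gamma> (c * a + e) (c * b + e)"
proof (rule curve_length_least)
  fix k and t :: "nat \<Rightarrow> real"
  assume "t 0 = a" "t k = b" "\<forall>i<k. t i < t (Suc i)"
  then show "ennreal (\<Sum>i<k. dist (\<gamma> (c * t i + e)) (\<gamma> (c * t (Suc i) + e)))
      \<le> curve_length \<gamma> (c * a + e) (c * b + e)"
    using curve_length_upper[of "\<lambda>i. c * t i + e" _ k] assms by auto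
qed

lemma curve_length_cong:
  assumes "\<And>s. s \<in> {a..b} \<Longrightarrow> \<gamma> s = \<gamma>' s"
  shows "curve_length \<gamma> a b = curve_length \<gamma>' a b"
proof -
  have "curve_length \<gamma> a b \<le> curve_length \<gamma>' a b"
    if eq: "\<And>s. s \<in> {a..b} \<Longrightarrow> \<gamma> s = \<gamma>' s" for \<gamma> \<gamma>' :: "real \<Rightarrow> 'a"
  proof (rule curve_length_least)
    fix k and t :: "nat \<Rightarrow> real"
    assume t: "t 0 = a" "t k = b" "\<forall>i<k. t i < t (Suc i)"
    then have "t i \<in> {a..b}" if "i \<le> k" for i
      using partition_mono[of k t 0 i] partition_mono[of k t i k] that by auto
    then have "(\<Sum>i<k. dist (\<gamma> (t i)) (\<gamma> (t (Suc i)))) = (\<Sum>i<k. dist (\<gamma>' (t i)) (\<gamma>' (t (Suc i))))"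
      by (intro sum.cong) (auto simp: eq)
    then show "ennreal (\<Sum>i<k. dist (\<gamma> (t i)) (\<gamma> (t (Suc i)))) \<le> curve_length \<gamma>' a b"
      using curve_length_upper[OF t] by simp
  qed
  from this[of \<gamma> \<gamma>'] this[of \<gamma>' \<gamma>] show ?thesis
    using assms by (simp add: order_antisym)
qed

text \<open>Reflection is an involution, so one inequality, used for the curve and for its
  reflection, gives equality.\<close>

lemma curve_length_reverse: "curve_length (\<lambda>s. \<gamma> (e - s)) (e - b) (e - a) = curve_length \<gamma> a b"
proof -
  have le: "curve_length (\<lambda>s. \<gamma> (e - s)) (e - b) (e - a) \<le> curve_length \<gamma> a b"
    for \<gamma> :: "real \<Rightarrow> 'a" and a b
  proof (rule curve_length_least)
    fix k and t :: "nat \<Rightarrow> real"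
    assume t: "t 0 = e - b" "t k = e - a" "\<forall>i<k. t i < t (Suc i)"
    \<comment> \<open>The reflected partition is read backwards so that it increases again.\<close>
    define t' where "t' = (\<lambda>i. e - t (k - i))"
    have "t' i < t' (Suc i)" if "i < k" for i
      using t(3)[rule_format, of "k - Suc i"] that by (simp add: t'_def Suc_diff_Suc)
    then have "ennreal (\<Sum>i<k. dist (\<gamma> (t' i)) (\<gamma> (t' (Suc i)))) \<le> curve_length \<gamma> a b"
      using t by (intro curve_length_upper) (auto simp: t'_def)
    also have "(\<Sum>i<k. dist (\<gamma> (t' i)) (\<gamma> (t' (Suc i)))) =
        (\<Sum>i<k. dist (\<gamma> (e - t (Suc (k - Suc i)))) (\<gamma> (e - t (k - Suc i))))"
      by (intro sum.cong) (auto simp: t'_def Suc_diff_Suc)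
    also have "\<dots> = (\<Sum>i<k. dist (\<gamma> (e - t i)) (\<gamma> (e - t (Suc i))))"
      by (subst sum.nat_diff_reindex[of "\<lambda>i. dist (\<gamma> (e - t (Suc i))) (\<gamma> (e - t i))"])
        (simp add: dist_commute)
    finally show "ennreal (\<Sum>i<k. dist (\<gamma> (e - t i)) (\<gamma> (e - t (Suc i)))) \<le> curve_length \<gamma> a b" .
  qed
  show ?thesis
    using le[of \<gamma> b a] le[of "\<lambda>s. \<gamma> (e - s)" "e - a" "e - b"] by simp
qed

section \<open>The induced length metric\<close>

lemma length_dist_refl:
  assumes "x \<in> X"
  shows "length_dist X x x = 0"
proof -
  have "length_dist X x x \<le> curve_length (\<lambda>_. x) 0 1"
    unfolding length_dist_def
    by (rule INF_lower)
      (use assms in \<open>auto simp: joining_path_def path_def path_image_def pathstart_def pathfinish_def\<close>)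
  also have "\<dots> \<le> 0" by (rule curve_length_least) simp
  finally show ?thesis by simp
qed

lemma length_dist_sym: "length_dist X x y = length_dist X y x"
proof -
  have "length_dist X x y \<le> length_dist X y x" for x y :: 'a
    unfolding length_dist_def
  proof (rule INF_greatest)
    fix \<gamma> assume \<gamma>: "\<gamma> \<in> {\<gamma>. joining_path X y x \<gamma>}"
    have "curve_length (reversepath \<gamma>) 0 1 = curve_length \<gamma> 0 1"
      using curve_length_reverse[of \<gamma> 1 1 0] by (simp add: reversepath_def)
    then show "Inf ((\<lambda>\<gamma>. curve_length \<gamma> 0 1) ` {\<gamma>. joining_path X x y \<gamma>}) \<le> curve_length \<gamma> 0 1"
      using \<gamma> by (intro INF_lower2[of "reversepath \<gamma>"]) (auto simp: joining_path_def)
  qed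
  from this[of x y] this[of y x] show ?thesis by (rule order_antisym)
qed

lemma dist_le_length_dist: "ennreal (dist x y) \<le> length_dist X x y"
  unfolding length_dist_def
proof (rule INF_greatest)
  fix \<gamma> assume "\<gamma> \<in> {\<gamma>. joining_path X x y \<gamma>}"
  then show "ennreal (dist x y) \<le> curve_length \<gamma> 0 1"
    using dist_le_curve_length[of 0 1 \<gamma>] by (auto simp: joining_path_def pathstart_def pathfinish_def)
qed

lemma curve_length_joinpaths_le:
  assumes "pathfinish \<gamma> = pathstart \<gamma>'"
  shows "curve_length (\<gamma> +++ \<gamma>') 0 1 \<le> curve_length \<gamma> 0 1 + curve_length \<gamma>' 0 1"
proof -
  have "curve_length (\<gamma> +++ \<gamma>') 0 1 \<le>
      curve_length (\<gamma> +++ \<gamma>') 0 (1/2) + curve_length (\<gamma> +++ \<gamma>') (1/2) 1"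
    by (rule curve_length_subadditive) auto
  also have "curve_length (\<gamma> +++ \<gamma>') 0 (1/2) = curve_length (\<lambda>s. \<gamma> (2 * s + 0)) 0 (1/2)"
    by (rule curve_length_cong) (auto simp: joinpaths_def)
  also have "curve_length (\<gamma> +++ \<gamma>') (1/2) 1 = curve_length (\<lambda>s. \<gamma>' (2 * s + (-1))) (1/2) 1"
  proof (rule curve_length_cong)
    fix s :: real assume "s \<in> {1/2..1}"
    \<comment> \<open>At \<open>s = 1/2\<close> the concatenation takes its value from
      \<open>\<gamma>\<close>, so the common endpoint enters here.\<close>
    moreover have "\<gamma> 1 = \<gamma>' 0" using assms by (simp add: pathfinish_def pathstart_def)
    ultimately show "(\<gamma> +++ \<gamma>') s = \<gamma>' (2 * s + (-1))"
      by (cases "s = 1/2") (simp only:, simp add: joinpaths_def, auto simp: joinpaths_def)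
  qed
  also have "curve_length (\<lambda>s. \<gamma> (2 * s + 0)) 0 (1/2) + curve_length (\<lambda>s. \<gamma>' (2 * s + (-1))) (1/2) 1
      \<le> curve_length \<gamma> 0 1 + curve_length \<gamma>' 0 1"
    using curve_length_affine_le[of 2 \<gamma> 0 0 "1/2"] curve_length_affine_le[of 2 \<gamma>' "-1" "1/2" 1]
    by (intro add_mono) simp_all
  finally show ?thesis .
qed

text \<open>In a geodesic subspace the infima are attained, so two minimizing paths can be
  concatenated without approximation.\<close>

lemma length_dist_triangle:
  assumes "geodesic_subspace X" "x \<in> X" "y \<in> X" "z \<in> X"
  shows "length_dist X x z \<le> length_dist X x y + length_dist X y z"
proof -
  obtain \<gamma> where \<gamma>: "joining_path X x y \<gamma>" "curve_length \<gamma> 0 1 = length_dist X x y"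
    using assms unfolding geodesic_subspace_def by blast
  obtain \<gamma>' where \<gamma>': "joining_path X y z \<gamma>'" "curve_length \<gamma>' 0 1 = length_dist X y z"
    using assms unfolding geodesic_subspace_def by blast
  have "joining_path X x z (\<gamma> +++ \<gamma>')"
    using \<gamma>(1) \<gamma>'(1) by (auto simp: joining_path_def path_image_join)
  then have "length_dist X x z \<le> curve_length (\<gamma> +++ \<gamma>') 0 1"
    unfolding length_dist_def by (intro INF_lower) simp
  also have "\<dots> \<le> length_dist X x y + length_dist X y z"
    using curve_length_joinpaths_le[of \<gamma> \<gamma>'] \<gamma> \<gamma>' by (simp add: joining_path_def)
  finally show ?thesis .
qed

section \<open>Minimizing geodesics in arc-length parametrization\<close>

lemma minimizing_geodesic_length:
  assumes "minimizing_geodesic X l \<gamma>"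
  shows "length_dist X (\<gamma> 0) (\<gamma> l) = ennreal l"
  using assms by (auto simp: minimizing_geodesic_def)

text \<open>Between two parameters the length from the start grows by exactly their difference, and
  by at least the chord.\<close>

lemma minimizing_geodesic_nonexpansive:
  assumes "minimizing_geodesic X l \<gamma>" "s \<in> {0..l}" "t \<in> {0..l}"
  shows "dist (\<gamma> s) (\<gamma> t) \<le> \<bar>s - t\<bar>"
proof -
  have "dist (\<gamma> s) (\<gamma> t) \<le> t - s" if "s \<in> {0..l}" "t \<in> {0..l}" "s \<le> t" for s t
  proof -
    have "ennreal s + ennreal (dist (\<gamma> s) (\<gamma> t)) \<le> ennreal t"
      using curve_length_append[of 0 s t \<gamma>] that assms(1) by (auto simp: minimizing_geodesic_def)
    then show ?thesis
      using that by (simp flip: ennreal_plus)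
  qed
  from this[of s t] this[of t s] show ?thesis
    using assms by (cases "s \<le> t") (auto simp: dist_commute)
qed

lemma curve_length_nonexpansive_le:
  assumes "\<And>s t. s \<in> {a..b} \<Longrightarrow> t \<in> {a..b} \<Longrightarrow> dist (\<gamma> s) (\<gamma> t) \<le> \<bar>s - t\<bar>"
  shows "curve_length \<gamma> a b \<le> ennreal (b - a)"
proof (rule curve_length_least)
  fix k and t :: "nat \<Rightarrow> real"
  assume t: "t 0 = a" "t k = b" "\<forall>i<k. t i < t (Suc i)"
  then have "t i \<in> {a..b}" if "i \<le> k" for i
    using partition_mono[of k t 0 i] partition_mono[of k t i k] that by auto
  then have "(\<Sum>i<k. dist (\<gamma> (t i)) (\<gamma> (t (Suc i)))) \<le> (\<Sum>i<k. \<bar>t i - t (Suc i)\<bar>)"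
    by (intro sum_mono assms) auto
  also have "\<dots> = (\<Sum>i<k. t (Suc i) - t i)"
    using t(3) by (intro sum.cong) (auto simp: less_imp_le)
  also have "\<dots> = b - a"
    using t by (simp add: sum_lessThan_telescope)
  finally show "ennreal (\<Sum>i<k. dist (\<gamma> (t i)) (\<gamma> (t (Suc i)))) \<le> ennreal (b - a)"
    by (rule ennreal_leI)
qed

text \<open>What needs work is that the reversed curve again has arc-length parametrization. A final
  segment of \<open>\<gamma>\<close> is not too long because \<open>\<gamma>\<close> is
  nonexpansive, and not too short because the whole has length \<open>l\<close> and length is
  subadditive.\<close>

lemma joining_geodesic_reverse:
  assumes "joining_geodesic X x y l \<gamma>"
  shows "joining_geodesic X y x l (\<lambda>s. \<gamma> (l - s))"
proof -
  have \<gamma>: "minimizing_geodesic X l \<gamma>" and xy: "\<gamma> 0 = x" "\<gamma> l = y" and l: "0 \<le> l"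
    and cont: "continuous_on {0..l} \<gamma>" and im: "\<gamma> ` {0..l} \<subseteq> X"
    and len: "\<And>s. s \<in> {0..l} \<Longrightarrow> curve_length \<gamma> 0 s = ennreal s"
    using assms by (auto simp: joining_geodesic_def minimizing_geodesic_def)
  have rlen: "curve_length (\<lambda>s. \<gamma> (l - s)) 0 s = ennreal s" if s: "s \<in> {0..l}" for s
  proof -
    have "curve_length (\<lambda>s. \<gamma> (l - s)) 0 s = curve_length \<gamma> (l - s) l"
      using curve_length_reverse[of \<gamma> l l "l - s"] by simp
    also have "\<dots> = ennreal s"
    proof (rule order_antisym)
      show "curve_length \<gamma> (l - s) l \<le> ennreal s"
        using curve_length_nonexpansive_le[of "l - s" l \<gamma>]
          minimizing_geodesic_nonexpansive[OF \<gamma>] s by auto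
      have "ennreal l \<le> ennreal (l - s) + curve_length \<gamma> (l - s) l"
        using curve_length_subadditive[of 0 "l - s" l \<gamma>] s len l by auto
      then show "ennreal s \<le> curve_length \<gamma> (l - s) l"
        using s by (cases "curve_length \<gamma> (l - s) l") (auto simp flip: ennreal_plus)
    qed
    finally show ?thesis .
  qed
  have "length_dist X y x = ennreal l"
    using minimizing_geodesic_length[OF \<gamma>] xy length_dist_sym[of X y x] by simp
  moreover have "continuous_on {0..l} (\<lambda>s. \<gamma> (l - s))"
    by (rule continuous_on_compose2[OF cont]) (auto intro!: continuous_intros)
  ultimately show ?thesis
    using rlen l im xy unfolding joining_geodesic_def minimizing_geodesic_def by auto
qed

section \<open>Geodesics below the convexity radius\<close>

text \<open>Real constants replace the extended ones: \<open>D\<close> stands for the distortion,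
  and \<open>r\<close> for one radius satisfying the three conditions whose supremum is the
  convexity radius.\<close>

locale convex_subspace =
  fixes X :: "'a::metric_space set" and r D :: real
  assumes geodesic: "geodesic_subspace X"
    and D_nonneg: "0 \<le> D"
    and length_dist_le: "\<And>x y. x \<in> X \<Longrightarrow> y \<in> X \<Longrightarrow> length_dist X x y \<le> ennreal (D * dist x y)"
    and unique_geodesics: "unique_geodesics_within X r"
    and convex_distances: "convex_distances_within X r"
    and contracting_geodesics: "contracting_geodesics_within X r"
begin

section \<open>The length metric with real values, finite on \<open>X\<close>\<close>

definition d :: "'a \<Rightarrow> 'a \<Rightarrow> real" where
  "d x y = enn2real (length_dist X x y)"

lemma length_dist_eq:
  assumes "x \<in> X" "y \<in> X"
  shows "length_dist X x y = ennreal (d x y)"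
  using length_dist_le[OF assms] by (cases "length_dist X x y") (auto simp: d_def top_unique)

lemma d_nonneg [simp]: "0 \<le> d x y"
  by (simp add: d_def)

lemma d_sym: "d x y = d y x"
  unfolding d_def by (subst length_dist_sym) (rule refl)

lemma d_triangle:
  assumes "x \<in> X" "y \<in> X" "z \<in> X"
  shows "d x z \<le> d x y + d y z"
  using length_dist_triangle[OF geodesic assms] assms
  by (simp add: length_dist_eq flip: ennreal_plus)

lemma dist_le_d:
  assumes "x \<in> X" "y \<in> X"
  shows "dist x y \<le> d x y"
  using dist_le_length_dist[of x y X] assms by (simp add: length_dist_eq)

lemma d_le:
  assumes "x \<in> X" "y \<in> X"
  shows "d x y \<le> D * dist x y"
  using length_dist_le[OF assms] assms D_nonneg by (simp add: length_dist_eq)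

text \<open>Constant-speed parametrization on \<open>{0..1}\<close>. Below \<open>r\<close>
  geodesics are unique, so the choice does not matter there.\<close>

definition geodesic_point :: "'a \<Rightarrow> 'a \<Rightarrow> real \<Rightarrow> 'a" where
  "geodesic_point x y t = (SOME \<gamma>. joining_geodesic X x y (d x y) \<gamma>) (t * d x y)"

lemma joining_geodesic_unique:
  assumes "x \<in> X" "y \<in> X" "d x y < r"
    and "joining_geodesic X x y l \<gamma>" "joining_geodesic X x y l' \<gamma>'" "s \<in> {0..l}"
  shows "\<gamma> s = \<gamma>' s"
proof -
  have "length_dist X x y < ennreal (2 * r)"
    using assms(1-3) d_nonneg[of x y] by (auto simp: length_dist_eq ennreal_less_iff simp del: d_nonneg)
  with unique_geodesics assms(1,2) obtain l0 \<gamma>0 where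
    "\<And>l' \<gamma>'. joining_geodesic X x y l' \<gamma>' \<Longrightarrow> l' = l0 \<and> (\<forall>s\<in>{0..l0}. \<gamma>' s = \<gamma>0 s)"
    unfolding unique_geodesics_within_def by meson
  from this[OF assms(4)] this[OF assms(5)] show ?thesis
    using assms(6) by auto
qed

lemma obtain_geodesic:
  assumes "x \<in> X" "y \<in> X" "d x y < r"
  obtains \<gamma> where "joining_geodesic X x y (d x y) \<gamma>"
    "\<And>t. geodesic_point x y t = \<gamma> (t * d x y)"
proof -
  have "length_dist X x y < ennreal (2 * r)"
    using assms d_nonneg[of x y] by (auto simp: length_dist_eq ennreal_less_iff simp del: d_nonneg)
  with unique_geodesics assms(1,2) obtain l \<gamma> where \<gamma>: "joining_geodesic X x y l \<gamma>"
    unfolding unique_geodesics_within_def by meson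
  then have "length_dist X x y = ennreal l" "0 \<le> l"
    using minimizing_geodesic_length[of X l \<gamma>] by (auto simp: joining_geodesic_def minimizing_geodesic_def)
  then have "joining_geodesic X x y (d x y) \<gamma>"
    using \<gamma> by (simp add: d_def)
  then have "joining_geodesic X x y (d x y) (SOME \<gamma>. joining_geodesic X x y (d x y) \<gamma>)"
    by (rule someI[of "joining_geodesic X x y (d x y)"])
  then show ?thesis
    by (rule that) (simp add: geodesic_point_def)
qed

lemma scaled_mem: "t \<in> {0..1} \<Longrightarrow> t * d x y \<in> {0..d x y}"
  by (auto simp: mult_left_le_one_le)

lemma geodesic_point_in:
  assumes "x \<in> X" "y \<in> X" "d x y < r" "t \<in> {0..1}"
  shows "geodesic_point x y t \<in> X"
proof -
  obtain \<gamma> where "joining_geodesic X x y (d x y) \<gamma>"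
    and eq: "\<And>t. geodesic_point x y t = \<gamma> (t * d x y)"
    using obtain_geodesic[OF assms(1-3)] by blast
  then have "\<gamma> ` {0..d x y} \<subseteq> X" by (simp add: joining_geodesic_def minimizing_geodesic_def)
  then show ?thesis using scaled_mem[OF assms(4)] eq by blast
qed

lemma geodesic_point_0 [simp]:
  assumes "x \<in> X" "y \<in> X" "d x y < r"
  shows "geodesic_point x y 0 = x"
proof -
  obtain \<gamma> where "joining_geodesic X x y (d x y) \<gamma>" "\<And>t. geodesic_point x y t = \<gamma> (t * d x y)"
    using obtain_geodesic[OF assms] by blast
  then show ?thesis by (simp add: joining_geodesic_def)
qed

lemma geodesic_point_1 [simp]:
  assumes "x \<in> X" "y \<in> X" "d x y < r"
  shows "geodesic_point x y 1 = y"
proof -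
  obtain \<gamma> where "joining_geodesic X x y (d x y) \<gamma>" "\<And>t. geodesic_point x y t = \<gamma> (t * d x y)"
    using obtain_geodesic[OF assms] by blast
  then show ?thesis by (simp add: joining_geodesic_def)
qed

text \<open>The two sides come from independent choices; uniqueness identifies one geodesic with the
  reverse of the other.\<close>

lemma geodesic_point_rev:
  assumes "x \<in> X" "y \<in> X" "d x y < r" "t \<in> {0..1}"
  shows "geodesic_point x y t = geodesic_point y x (1 - t)"
proof -
  obtain \<gamma> where \<gamma>: "joining_geodesic X x y (d x y) \<gamma>"
    "\<And>t. geodesic_point x y t = \<gamma> (t * d x y)"
    using obtain_geodesic[OF assms(1-3)] by blast
  obtain \<gamma>' where \<gamma>': "joining_geodesic X y x (d y x) \<gamma>'"
    "\<And>t. geodesic_point y x t = \<gamma>' (t * d y x)"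
    using obtain_geodesic[of y x] assms d_sym[of x y] by auto
  have "\<gamma> (t * d x y) = \<gamma>' (d x y - t * d x y)"
    using joining_geodesic_unique[OF assms(1-3) \<gamma>(1) joining_geodesic_reverse[OF \<gamma>'(1)]]
      scaled_mem[OF assms(4)] d_sym[of y x] by simp
  then show ?thesis
    using \<gamma>(2) \<gamma>'(2) d_sym[of y x] by (simp add: algebra_simps)
qed

lemma geodesic_point_lipschitz:
  assumes "x \<in> X" "y \<in> X" "d x y < r" "s \<in> {0..1}" "t \<in> {0..1}"
  shows "dist (geodesic_point x y s) (geodesic_point x y t) \<le> \<bar>s - t\<bar> * r"
proof -
  obtain \<gamma> where \<gamma>: "joining_geodesic X x y (d x y) \<gamma>"
    and eq: "\<And>t. geodesic_point x y t = \<gamma> (t * d x y)"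
    using obtain_geodesic[OF assms(1-3)] by blast
  have "dist (\<gamma> (s * d x y)) (\<gamma> (t * d x y)) \<le> \<bar>s * d x y - t * d x y\<bar>"
    using \<gamma> assms(4,5) unfolding joining_geodesic_def
    by (intro minimizing_geodesic_nonexpansive[of X "d x y"] scaled_mem) auto
  also have "\<dots> = \<bar>s - t\<bar> * d x y"
    by (simp add: abs_mult flip: left_diff_distrib)
  also have "\<dots> \<le> \<bar>s - t\<bar> * r"
    using assms(3) by (intro mult_left_mono) auto
  finally show ?thesis by (simp add: eq)
qed

lemma geodesic_point_convex:
  assumes "x \<in> X" "y \<in> X" "z \<in> X" "d x y < r" "d y z < r" "d z x < r" "t \<in> {0..1}"
  shows "d (geodesic_point x y t) z \<le> max (d x z) (d y z)"
proof -
  obtain \<gamma> where \<gamma>: "joining_geodesic X x y (d x y) \<gamma>"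
    and eq: "\<And>t. geodesic_point x y t = \<gamma> (t * d x y)"
    using obtain_geodesic[of x y] assms by blast
  let ?u = "geodesic_point x y t"
  have u: "?u \<in> X" using assms by (intro geodesic_point_in)
  have "\<exists>l \<gamma>. joining_geodesic X x y l \<gamma> \<and> ?u \<in> \<gamma> ` {0..l}"
    using \<gamma> eq scaled_mem[OF assms(7)] by blast
  then have "length_dist X ?u z \<le> max (length_dist X x z) (length_dist X y z)"
    using convex_distances[unfolded convex_distances_within_def] assms u
    by (auto simp: length_dist_eq ennreal_less_iff)
  then show ?thesis
    using assms u by (auto simp: length_dist_eq le_max_iff_disj)
qed

lemma geodesic_point_contracting:
  assumes "x \<in> X" "y \<in> X" "y' \<in> X" "d x y < r" "d x y' < r" "t \<in> {0..1}"
  shows "d (geodesic_point x y t) (geodesic_point x y' t) \<le> d y y'"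
proof -
  obtain \<gamma> where \<gamma>: "joining_geodesic X x y (d x y) \<gamma>"
    "\<And>t. geodesic_point x y t = \<gamma> (t * d x y)"
    using obtain_geodesic[of x y] assms by blast
  obtain \<gamma>' where \<gamma>': "joining_geodesic X x y' (d x y') \<gamma>'"
    "\<And>t. geodesic_point x y' t = \<gamma>' (t * d x y')"
    using obtain_geodesic[of x y'] assms by blast
  have "length_dist X (\<gamma> (t * d x y)) (\<gamma>' (t * d x y')) \<le> length_dist X (\<gamma> (d x y)) (\<gamma>' (d x y'))"
    \<comment> \<open>The contraction condition is taken at the far ends of both geodesics, where
      the parameters equal the lengths.\<close>
    using contracting_geodesics[unfolded contracting_geodesics_within_def, rule_format,
        of "d x y" \<gamma> "d x y'" \<gamma>' "d x y" "d x y'" t] \<gamma>(1) \<gamma>'(1) assms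
    by (simp add: joining_geodesic_def)
  then have "length_dist X (geodesic_point x y t) (geodesic_point x y' t) \<le> length_dist X y y'"
    using \<gamma> \<gamma>' by (simp add: joining_geodesic_def)
  then show ?thesis
    using assms geodesic_point_in by (simp add: length_dist_eq)
qed

text \<open>The contraction condition concerns geodesics with a common start; reversal carries it
  over to a common end.\<close>

lemma geodesic_point_contracting':
  assumes "x \<in> X" "x' \<in> X" "y \<in> X" "d x y < r" "d x' y < r" "t \<in> {0..1}"
  shows "d (geodesic_point x y t) (geodesic_point x' y t) \<le> d x x'"
  using geodesic_point_contracting[of y x x' "1 - t"] geodesic_point_rev[of x y t]
    geodesic_point_rev[of x' y t] assms d_sym by simp

text \<open>From \<open>a\<close> to a nearby \<open>b\<close>, the start point, the end point and
  the parameter are changed one at a time, each at a controlled rate. The intermediate geodesic from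
  \<open>f a\<close> to \<open>h b\<close> is below \<open>r\<close> for \<open>b\<close> near
  \<open>a\<close>, since \<open>d (f a) (h a) < r\<close> is strict.\<close>

lemma continuous_on_geodesic_point:
  fixes f h :: "'b::topological_space \<Rightarrow> 'a"
  assumes cont: "continuous_on A f" "continuous_on A h" "continuous_on A \<tau>"
    and mem: "\<And>a. a \<in> A \<Longrightarrow> f a \<in> X" "\<And>a. a \<in> A \<Longrightarrow> h a \<in> X" "\<And>a. a \<in> A \<Longrightarrow> \<tau> a \<in> {0..1}"
    and close: "\<And>a. a \<in> A \<Longrightarrow> d (f a) (h a) < r"
  shows "continuous_on A (\<lambda>a. geodesic_point (f a) (h a) (\<tau> a))"
  unfolding continuous_on_def
proof
  fix a assume a: "a \<in> A"
  let ?F = "at a within A"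
  let ?g = "\<lambda>a. geodesic_point (f a) (h a) (\<tau> a)"
  have f: "(f \<longlongrightarrow> f a) ?F" and h: "(h \<longlongrightarrow> h a) ?F" and \<tau>: "(\<tau> \<longlongrightarrow> \<tau> a) ?F"
    using cont a by (auto simp: continuous_on_def)
  have "((\<lambda>b. d (f a) (h a) + D * dist (h a) (h b)) \<longlongrightarrow> d (f a) (h a) + D * dist (h a) (h a)) ?F"
    by (intro tendsto_intros h)
  then have "eventually (\<lambda>b. d (f a) (h a) + D * dist (h a) (h b) < r) ?F"
    using close[OF a] by (intro order_tendstoD(2)) auto
  moreover have "eventually (\<lambda>b. b \<in> A) ?F"
    by (simp add: eventually_at_filter)
  ultimately have bound: "eventually (\<lambda>b. dist (?g b) (?g a) \<le>
      D * dist (f b) (f a) + D * dist (h b) (h a) + \<bar>\<tau> b - \<tau> a\<bar> * r) ?F"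
  proof eventually_elim
    case (elim b)
    have "d (f a) (h b) \<le> d (f a) (h a) + d (h a) (h b)"
      using a elim mem by (intro d_triangle) auto
    also have "d (h a) (h b) \<le> D * dist (h a) (h b)"
      using a elim mem by (intro d_le) auto
    finally have ab: "d (f a) (h b) < r" using elim by simp
    note facts = mem[OF a] mem[OF elim(2)] close[OF a] close[OF elim(2)] ab
    have "dist (?g b) (geodesic_point (f a) (h b) (\<tau> b)) \<le> d (f b) (f a)"
      using facts by (intro order_trans[OF dist_le_d geodesic_point_contracting'] geodesic_point_in)
    also have "\<dots> \<le> D * dist (f b) (f a)" using facts by (intro d_le)
    finally have 1: "dist (?g b) (geodesic_point (f a) (h b) (\<tau> b)) \<le> D * dist (f b) (f a)" .
    have "dist (geodesic_point (f a) (h b) (\<tau> b)) (geodesic_point (f a) (h a) (\<tau> b)) \<le> d (h b) (h a)"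
      using facts by (intro order_trans[OF dist_le_d geodesic_point_contracting] geodesic_point_in)
    also have "\<dots> \<le> D * dist (h b) (h a)" using facts by (intro d_le)
    finally have 2: "dist (geodesic_point (f a) (h b) (\<tau> b)) (geodesic_point (f a) (h a) (\<tau> b))
        \<le> D * dist (h b) (h a)" .
    have 3: "dist (geodesic_point (f a) (h a) (\<tau> b)) (?g a) \<le> \<bar>\<tau> b - \<tau> a\<bar> * r"
      using facts by (intro geodesic_point_lipschitz)
    show ?case
      using 1 2 3 dist_triangle[of "?g b" "?g a" "geodesic_point (f a) (h b) (\<tau> b)"]
        dist_triangle[of "geodesic_point (f a) (h b) (\<tau> b)" "?g a" "geodesic_point (f a) (h a) (\<tau> b)"]
      by linarith
  qed
  have "((\<lambda>b. D * dist (f b) (f a) + D * dist (h b) (h a) + \<bar>\<tau> b - \<tau> a\<bar> * r) \<longlongrightarrow>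
      D * dist (f a) (f a) + D * dist (h a) (h a) + \<bar>\<tau> a - \<tau> a\<bar> * r) ?F"
    by (intro tendsto_intros f h \<tau>)
  then have lim: "((\<lambda>b. D * dist (f b) (f a) + D * dist (h b) (h a) + \<bar>\<tau> b - \<tau> a\<bar> * r) \<longlongrightarrow> 0) ?F"
    by simp
  have "((\<lambda>b. dist (?g b) (?g a)) \<longlongrightarrow> 0) ?F"
    by (rule tendsto_sandwich[OF _ bound tendsto_const lim]) simp
  then show "(?g \<longlongrightarrow> ?g a) ?F"
    by (rule iffD2[OF tendsto_dist_iff])
qed

section \<open>Geodesic simplices\<close>

text \<open>
  The geodesic simplex with vertices \<open>g v\<close>, built by successive geodesic coning in the order of
  the list.  Since vertices of weight zero are skipped, its restriction to a face is the geodesic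
  simplex of the face.
\<close>

primrec geodesic_simplex :: "('v \<Rightarrow> 'a) \<Rightarrow> 'v list \<Rightarrow> ('v \<Rightarrow> real) \<Rightarrow> 'a" where
  "geodesic_simplex g [] p = undefined"
| "geodesic_simplex g (v # vs) p =
    (if sum_list (map p vs) = 0 then g v
     else if p v = 0 then geodesic_simplex g vs p
     else geodesic_point (geodesic_simplex g vs p) (g v) (p v / sum_list (map p (v # vs))))"

text \<open>By convexity of distances, a ball of radius below \<open>r\<close> that contains the
  vertices contains every coning step. Existence and the bound are proved together, because the next
  geodesic exists only if the cone point so far is close to the new vertex.\<close>

lemma geodesic_simplex_hull:
  assumes p: "p \<in> closed_simplex \<sigma>" and "0 < sum_list (map p vs)"
    and g: "\<And>v. v \<in> \<sigma> \<Longrightarrow> g v \<in> X"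
    and close: "\<And>u v. u \<in> \<sigma> \<Longrightarrow> v \<in> \<sigma> \<Longrightarrow> d (g u) (g v) \<le> \<Delta>" and \<Delta>: "\<Delta> < r"
  shows "geodesic_simplex g vs p \<in> X \<and>
    (\<forall>z\<in>X. \<forall>E<r. (\<forall>v\<in>\<sigma>. d (g v) z \<le> E) \<longrightarrow> d (geodesic_simplex g vs p) z \<le> E)"
  using assms(2)
proof (induction vs)
  case (Cons v vs)
  have nonneg: "0 \<le> p u" for u using p by (simp add: closed_simplex_def)
  have v: "v \<in> \<sigma>" if "p v \<noteq> 0" using p that by (auto simp: closed_simplex_def)
  show ?case
  proof (cases "sum_list (map p vs) = 0")
    case True
    then have "v \<in> \<sigma>" using Cons.prems v by auto
    with True show ?thesis using g by simp
  next
    case False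
    let ?c = "geodesic_simplex g vs p"
    have pos: "0 < sum_list (map p vs)"
      using False sum_list_nonneg[of "map p vs"] nonneg by fastforce
    note IH = Cons.IH[OF pos]
    show ?thesis
    proof (cases "p v = 0")
      case True
      then show ?thesis using IH False by simp
    next
      case pv: False
      let ?t = "p v / sum_list (map p (v # vs))"
      have t: "?t \<in> {0..1}" using pos nonneg[of v] by (auto simp: divide_le_eq_1)
      \<comment> \<open>The induction hypothesis is used with the new vertex as \<open>z\<close> and
        \<open>\<Delta>\<close> as \<open>E\<close>.\<close>
      have "d ?c (g v) \<le> \<Delta>" using IH v[OF pv] g close \<Delta> by auto
      with \<Delta> have lt: "d ?c (g v) < r" by simp
      have "geodesic_point ?c (g v) ?t \<in> X"
        using IH g v[OF pv] lt t by (intro geodesic_point_in) auto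
      moreover have "d (geodesic_point ?c (g v) ?t) z \<le> E"
        if z: "z \<in> X" "E < r" "\<forall>v\<in>\<sigma>. d (g v) z \<le> E" for z E
      proof -
        have cz: "d ?c z \<le> E" and vz: "d (g v) z \<le> E" using IH z v[OF pv] by auto
        have "d (geodesic_point ?c (g v) ?t) z \<le> max (d ?c z) (d (g v) z)"
          using IH g v[OF pv] lt t z(1)
            le_less_trans[OF cz z(2)] le_less_trans[OF vz z(2)] d_sym[of z ?c]
          by (intro geodesic_point_convex) auto
        then show ?thesis using cz vz by simp
      qed
      ultimately show ?thesis using False pv by simp
    qed
  qed
qed simp

lemma continuous_on_sum_list_coordinates:
  "continuous_on A (\<lambda>p :: 'v \<Rightarrow> real. sum_list (map p vs))"
  by (induction vs)
    (auto intro!: continuous_intros intro: continuous_on_subset[OF continuous_on_product_coordinates])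

text \<open>Where the tail \<open>vs\<close> carries weight, continuity is inherited from geodesics.
  Where all weight sits on \<open>v\<close>, the cone point of the tail has no limit in general, but
  the parameter tends to 1 and the geodesics are shorter than \<open>r\<close>, so the values still
  tend to \<open>g v\<close>.\<close>

lemma continuous_on_geodesic_simplex:
  assumes g: "\<And>v. v \<in> \<sigma> \<Longrightarrow> g v \<in> X"
    and close: "\<And>u v. u \<in> \<sigma> \<Longrightarrow> v \<in> \<sigma> \<Longrightarrow> d (g u) (g v) \<le> \<Delta>" and \<Delta>: "\<Delta> < r"
  shows "continuous_on {p \<in> closed_simplex \<sigma>. 0 < sum_list (map p vs)} (geodesic_simplex g vs)"
proof (induction vs)
  case (Cons v vs)
  have nonneg: "0 \<le> p u" if "p \<in> closed_simplex \<sigma>" for p u using that by (simp add: closed_simplex_def)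
  have w_nonneg: "0 \<le> sum_list (map p us)" if "p \<in> closed_simplex \<sigma>" for p us
    by (rule sum_list_nonneg) (use nonneg[OF that] in auto)
  define A where "A = {p \<in> closed_simplex \<sigma>. 0 < sum_list (map p (v # vs))}"
  define B where "B = {p \<in> closed_simplex \<sigma>. 0 < sum_list (map p vs)}"
  show ?case
  proof (cases "v \<in> \<sigma>")
    case False
    then have zero: "p v = 0" if "p \<in> closed_simplex \<sigma>" for p using that by (simp add: closed_simplex_def)
    have "sum_list (map p (v # vs)) = sum_list (map p vs)" if "p \<in> closed_simplex \<sigma>" for p
      using zero[OF that] by simp
    then have "A = B" unfolding A_def B_def by (metis (mono_tags, lifting) Collect_cong)
    moreover have "geodesic_simplex g (v # vs) p = geodesic_simplex g vs p" if "p \<in> B" for p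
      using that zero[of p] by (auto simp: B_def)
    ultimately show ?thesis
      using Cons.IH by (simp only: A_def[symmetric] B_def[symmetric] cong: continuous_on_cong)
  next
    case v: True
    let ?c = "geodesic_simplex g vs"
    let ?t = "\<lambda>p. p v / sum_list (map p (v # vs))"
    have hull: "?c p \<in> X" "d (?c p) (g v) < r" if "p \<in> B" for p
      using geodesic_simplex_hull[of p \<sigma> vs g \<Delta>] that g close \<Delta> v unfolding B_def by fastforce+
    have t: "?t p \<in> {0..1}" if "p \<in> A" for p
      using that nonneg[of p v] w_nonneg[of p vs] by (auto simp: A_def divide_le_eq_1)
    have t_cont: "continuous_on A ?t"
      by (intro continuous_on_divide continuous_on_sum_list_coordinates
          continuous_on_subset[OF continuous_on_product_coordinates]) (auto simp: A_def)
    have BA: "B \<subseteq> A" using nonneg[of _ v] by (auto simp: A_def B_def add_nonneg_pos)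
    \<comment> \<open>If \<open>p v = 0\<close>, the parameter is 0 and the geodesic formula returns
      its start, so both branches of the recursion agree.\<close>
    have eq: "geodesic_simplex g (v # vs) p = geodesic_point (?c p) (g v) (?t p)" if "p \<in> B" for p
      using that hull[OF that] g[OF v] by (auto simp: B_def)
    have contB: "continuous_on B (geodesic_simplex g (v # vs))"
    proof (rule continuous_on_eq[OF _ eq[symmetric]])
      show "continuous_on B (\<lambda>p. geodesic_point (?c p) (g v) (?t p))"
        using Cons.IH hull g v t BA t_cont
        by (intro continuous_on_geodesic_point) (auto simp flip: B_def elim: continuous_on_subset)
    qed
    have "continuous_on A (geodesic_simplex g (v # vs))"
      unfolding continuous_on_def
    proof
      fix p assume p: "p \<in> A"
      show "(geodesic_simplex g (v # vs) \<longlongrightarrow> geodesic_simplex g (v # vs) p) (at p within A)"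
      proof (cases "p \<in> B")
        case True
        \<comment> \<open>Positive weight of the tail is an open condition, so near a point of
          \<open>B\<close> the limit within \<open>A\<close> is the limit within
          \<open>B\<close>.\<close>
        have "open {p :: 'b \<Rightarrow> real. 0 < sum_list (map p vs)}"
          by (intro open_Collect_less continuous_on_sum_list_coordinates continuous_on_const)
        moreover have "A \<inter> {p. 0 < sum_list (map p vs)} = B"
          using BA by (auto simp: A_def B_def)
        ultimately have "at p within A = at p within B"
          using True by (intro at_within_nhd[of _ "{p. 0 < sum_list (map p vs)}"]) (auto simp: B_def)
        then show ?thesis using contB True by (simp only: continuous_on_def)
      next
        case False
        then have w0: "sum_list (map p vs) = 0"
          using p w_nonneg[of p vs] by (auto simp: A_def B_def)
        \<comment> \<open>On \<open>B\<close> this compares the geodesic at \<open>?t q\<close> with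
          its end at 1; off \<open>B\<close> both sides vanish.\<close>
        have bound: "dist (geodesic_simplex g (v # vs) q) (g v) \<le> (1 - ?t q) * r" if q: "q \<in> A" for q
        proof (cases "q \<in> B")
          case True
          have "dist (geodesic_simplex g (v # vs) q) (g v) =
              dist (geodesic_point (?c q) (g v) (?t q)) (geodesic_point (?c q) (g v) 1)"
            using hull[OF True] g[OF v] eq[OF True] by (simp only: geodesic_point_1)
          also have "\<dots> \<le> \<bar>?t q - 1\<bar> * r"
            using hull[OF True] g[OF v] t[OF q] by (intro geodesic_point_lipschitz) auto
          finally show ?thesis using t[OF q] by simp
        next
          case False
          then have "sum_list (map q vs) = 0"
            using q w_nonneg[of q vs] by (auto simp: A_def B_def)
          then show ?thesis using q by (auto simp: A_def)
        qed
        have "?t p = 1" using p w0 by (auto simp: A_def)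
        moreover have "((\<lambda>q. (1 - ?t q) * r) \<longlongrightarrow> (1 - ?t p) * r) (at p within A)"
          using t_cont[unfolded continuous_on_def, rule_format, OF p]
          by (rule tendsto_mult_right[OF tendsto_diff[OF tendsto_const]])
        ultimately have "((\<lambda>q. (1 - ?t q) * r) \<longlongrightarrow> 0) (at p within A)" by simp
        then have "((\<lambda>q. dist (geodesic_simplex g (v # vs) q) (g v)) \<longlongrightarrow> 0) (at p within A)"
          by (rule tendsto_sandwich[rotated 3]) (use bound in \<open>auto simp del: geodesic_simplex.simps simp: eventually_at_filter\<close>)
        moreover have "geodesic_simplex g (v # vs) p = g v" using w0 by simp
        ultimately show ?thesis
          by (simp only: tendsto_dist_iff[of _ "g v"])
      qed
    qed
    then show ?thesis by (simp only: A_def)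
  qed
qed simp

end

section \<open>Rips complexes and their realizations\<close>

lemma closed_closed_simplex: "closed (closed_simplex \<sigma>)"
proof -
  have coord: "continuous_on UNIV (\<lambda>p :: 'a \<Rightarrow> real. p v)" for v
    by simp
  have "closed_simplex \<sigma> = {p. \<forall>v. 0 \<le> p v} \<inter> {p. \<forall>v\<in>-\<sigma>. p v = 0} \<inter> {p. (\<Sum>v\<in>\<sigma>. p v) = 1}"
    by (auto simp: closed_simplex_def)
  also have "closed \<dots>"
    unfolding Ball_def
    by (intro closed_Int closed_Collect_all closed_Collect_imp closed_Collect_le closed_Collect_eq
        continuous_on_sum continuous_on_const coord) auto
  finally show ?thesis .
qed

text \<open>The part of each closed simplex outside a weakly open set is closed, and a finite union
  of closed sets is closed. Hence for finite complexes continuity can be checked in the product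
  topology.\<close>

lemma realization_eq_top_of_set:
  assumes "finite K"
  shows "realization K = top_of_set (\<Union>\<sigma>\<in>K. closed_simplex \<sigma>)"
  unfolding topology_eq
proof (intro allI iffI)
  fix U
  let ?T = "\<Union>\<sigma>\<in>K. closed_simplex \<sigma>"
  assume "openin (realization K) U"
  then have U: "U \<subseteq> ?T" "\<And>\<sigma>. \<sigma> \<in> K \<Longrightarrow> openin (top_of_set (closed_simplex \<sigma>)) (U \<inter> closed_simplex \<sigma>)"
    by (auto simp: openin_realization)
  have "closed (closed_simplex \<sigma> - U)" if "\<sigma> \<in> K" for \<sigma>
  proof -
    have "closedin (top_of_set (closed_simplex \<sigma>)) (closed_simplex \<sigma> - U \<inter> closed_simplex \<sigma>)"
      using U(2)[OF that] by (intro closedin_diff) auto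
    then have "closed (closed_simplex \<sigma> - U \<inter> closed_simplex \<sigma>)"
      using closed_closed_simplex by (rule closedin_closed_trans)
    then show ?thesis by (simp add: Diff_Int)
  qed
  then have "open (- (\<Union>\<sigma>\<in>K. closed_simplex \<sigma> - U))"
    using assms by (intro open_Compl closed_UN) auto
  moreover have "U = ?T \<inter> - (\<Union>\<sigma>\<in>K. closed_simplex \<sigma> - U)"
    using U(1) by blast
  ultimately show "openin (top_of_set ?T) U"
    unfolding openin_open by blast
next
  fix U
  assume "openin (top_of_set (\<Union>\<sigma>\<in>K. closed_simplex \<sigma>)) U"
  then obtain V where V: "open V" "U = (\<Union>\<sigma>\<in>K. closed_simplex \<sigma>) \<inter> V"
    by (auto simp: openin_open)
  have "U \<inter> closed_simplex \<sigma> = closed_simplex \<sigma> \<inter> V" if "\<sigma> \<in> K" for \<sigma>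
    using that V(2) by blast
  then show "openin (realization K) U"
    unfolding openin_realization using V by (auto simp: openin_open)
qed

lemma closed_simplex_mono:
  assumes "\<sigma> \<subseteq> \<tau>" "finite \<tau>"
  shows "closed_simplex \<sigma> \<subseteq> closed_simplex \<tau>"
proof
  fix p :: "'a \<Rightarrow> real" assume p: "p \<in> closed_simplex \<sigma>"
  then have "(\<Sum>v\<in>\<tau>. p v) = (\<Sum>v\<in>\<sigma>. p v)"
    using assms by (intro sum.mono_neutral_right) (auto simp: closed_simplex_def)
  then show "p \<in> closed_simplex \<tau>"
    using p assms by (auto simp: closed_simplex_def)
qed

lemma closed_simplex_convex_combination:
  assumes "p \<in> closed_simplex \<sigma>" "q \<in> closed_simplex \<sigma>" "t \<in> {0..1}"
  shows "(\<lambda>v. (1 - t) * p v + t * q v) \<in> closed_simplex \<sigma>"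
proof -
  have "(\<Sum>v\<in>\<sigma>. (1 - t) * p v + t * q v) = (1 - t) * (\<Sum>v\<in>\<sigma>. p v) + t * (\<Sum>v\<in>\<sigma>. q v)"
    by (simp add: sum.distrib sum_distrib_left)
  then show ?thesis
    using assms by (auto simp: closed_simplex_def)
qed

lemma realization_map_id: "realization_map (\<lambda>v. v) = (\<lambda>p. p)"
proof (intro ext)
  fix p :: "'a \<Rightarrow> real" and w
  have "{v. p v \<noteq> 0 \<and> v = w} = (if p w \<noteq> 0 then {w} else {})" by auto
  then show "realization_map (\<lambda>v. v) p w = p w"
    by (simp add: realization_map_def)
qed

lemma rips_complex_iff:
  "\<sigma> \<in> rips_complex \<alpha> A \<longleftrightarrow> finite \<sigma> \<and> \<sigma> \<noteq> {} \<and> \<sigma> \<subseteq> A \<and> (\<forall>x\<in>\<sigma>. \<forall>y\<in>\<sigma>. dist x y \<le> \<alpha>)"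
proof -
  have "diameter \<sigma> \<le> \<alpha> \<longleftrightarrow> (\<forall>x\<in>\<sigma>. \<forall>y\<in>\<sigma>. dist x y \<le> \<alpha>)" if "finite \<sigma>" "\<sigma> \<noteq> {}"
  proof
    assume "diameter \<sigma> \<le> \<alpha>"
    then show "\<forall>x\<in>\<sigma>. \<forall>y\<in>\<sigma>. dist x y \<le> \<alpha>"
      using diameter_bounded_bound[OF finite_imp_bounded[OF that(1)]] by (meson order_trans)
  next
    assume "\<forall>x\<in>\<sigma>. \<forall>y\<in>\<sigma>. dist x y \<le> \<alpha>"
    then show "diameter \<sigma> \<le> \<alpha>"
      using that by (auto simp: diameter_def intro!: cSUP_least)
  qed
  then show ?thesis by (auto simp: rips_complex_def)
qed

lemma finite_rips_complex:
  assumes "finite A"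
  shows "finite (rips_complex \<alpha> A)"
  by (rule finite_subset[of _ "Pow A"]) (auto simp: rips_complex_def assms)

text \<open>Tent functions around the points of \<open>S\<close>, normalized to a partition of unity
  and read as barycentric coordinates.\<close>

definition nearby_weights :: "'a::metric_space set \<Rightarrow> real \<Rightarrow> 'a \<Rightarrow> 'a \<Rightarrow> real" where
  "nearby_weights S e x s =
     (if s \<in> S then max 0 (e - dist x s) / (\<Sum>u\<in>S. max 0 (e - dist x u)) else 0)"

lemma nearby_weights_total_pos:
  assumes "finite S" "\<exists>s\<in>S. dist x s < e"
  shows "0 < (\<Sum>u\<in>S. max 0 (e - dist x u))"
proof -
  obtain s where "s \<in> S" "dist x s < e" using assms(2) by blast
  then show ?thesis using assms(1) by (intro sum_pos2[of S s]) auto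
qed

lemma nearby_weights_in_simplex:
  assumes "finite S" "\<exists>s\<in>S. dist x s < e"
  shows "nearby_weights S e x \<in> closed_simplex {s \<in> S. dist x s < e}"
proof -
  have "(\<Sum>s | s \<in> S \<and> dist x s < e. nearby_weights S e x s) = (\<Sum>s\<in>S. nearby_weights S e x s)"
    using assms(1) by (intro sum.mono_neutral_left) (auto simp: nearby_weights_def)
  also have "\<dots> = 1"
    using nearby_weights_total_pos[OF assms] by (simp add: nearby_weights_def flip: sum_divide_distrib)
  finally show ?thesis
    using nearby_weights_total_pos[OF assms]
    by (auto simp: closed_simplex_def nearby_weights_def)
qed

lemma continuous_on_nearby_weights:
  assumes "finite S" "\<And>x. x \<in> X \<Longrightarrow> \<exists>s\<in>S. dist x s < e"
  shows "continuous_on X (nearby_weights S e)"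
proof (rule continuous_on_coordinatewise_then_product)
  fix s
  have "(\<Sum>u\<in>S. max 0 (e - dist x u)) \<noteq> 0" if "x \<in> X" for x
    using nearby_weights_total_pos[OF assms(1) assms(2)[OF that]] by simp
  then show "continuous_on X (\<lambda>x. nearby_weights S e x s)"
    by (cases "s \<in> S") (auto simp: nearby_weights_def intro!: continuous_intros)
qed

section \<open>Homology of a convex subspace\<close>

lemma homotopic_with_top_of_setI:
  fixes h :: "real \<times> 'a::topological_space \<Rightarrow> 'b::topological_space"
  assumes "continuous_on ({0..1} \<times> A) h" "\<And>t x. t \<in> {0..1} \<Longrightarrow> x \<in> A \<Longrightarrow> h (t, x) \<in> B"
    and "\<And>x. x \<in> A \<Longrightarrow> h (0, x) = f x" "\<And>x. x \<in> A \<Longrightarrow> h (1, x) = g x"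
  shows "homotopic_with (\<lambda>h. True) (top_of_set A) (top_of_set B) f g"
proof -
  have "continuous_map (prod_topology (top_of_set {0..1}) (top_of_set A)) (top_of_set B) h"
    using assms(1,2) by auto
  then show ?thesis
    using assms(3,4) by (subst homotopic_with) auto
qed

text \<open>In homology \<open>q\<close> is a left inverse of \<open>j \<circ> p\<close> by the
  first homotopy, so \<open>j \<circ> p\<close> is injective. By the second, \<open>j\<close>
  factors through \<open>j \<circ> p\<close>, and conversely \<open>j \<circ> p\<close> factors
  through \<open>j\<close>; so the images coincide.\<close>

lemma homology_iso_hom_image:
  assumes p: "continuous_map X K p" and j: "continuous_map K L j" and q: "continuous_map L X q"
    and qjp: "homotopic_with (\<lambda>h. True) X X (q \<circ> j \<circ> p) id"
    and jpqj: "homotopic_with (\<lambda>h. True) K L (j \<circ> p \<circ> q \<circ> j) j"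
  shows "homology_group k X \<cong>
    hom_image (homology_group k K) (homology_group k L) (hom_induced k K {} L {} j)"
proof -
  let ?p = "hom_induced k X {} K {} p" and ?j = "hom_induced k K {} L {} j"
    and ?q = "hom_induced k L {} X {} q"
  have qj: "hom_induced k K {} X {} (q \<circ> j) = ?q \<circ> ?j"
    by (rule hom_induced_compose_empty[OF j q])
  have "?q (?j (?p c)) = c" if "c \<in> carrier (homology_group k X)" for c
  proof -
    have "hom_induced k X {} X {} (q \<circ> j \<circ> p) = ?q \<circ> ?j \<circ> ?p"
      using hom_induced_compose_empty[OF p continuous_map_compose[OF j q], of k] qj by simp
    moreover have "hom_induced k X {} X {} (q \<circ> j \<circ> p) c = c"
      using homology_homotopy_empty[OF qjp] hom_induced_id[OF that] by simp
    ultimately show ?thesis by (simp only: comp_apply)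
  qed
  then have inj: "inj_on (?j \<circ> ?p) (carrier (homology_group k X))"
    by (intro inj_on_inverseI[of _ ?q]) simp
  have jpqj_eq: "?j (?p (?q (?j c))) = ?j c" for c
  proof -
    have "hom_induced k K {} L {} (j \<circ> p \<circ> (q \<circ> j)) = ?j \<circ> ?p \<circ> (?q \<circ> ?j)"
      using hom_induced_compose_empty[OF continuous_map_compose[OF j q] continuous_map_compose[OF p j], of k]
        hom_induced_compose_empty[OF p j, of k] qj by simp
    moreover have "hom_induced k K {} L {} (j \<circ> p \<circ> (q \<circ> j)) = ?j"
      using homology_homotopy_empty[OF jpqj, of k] by (simp only: comp_assoc)
    ultimately have "(?j \<circ> ?p \<circ> (?q \<circ> ?j)) c = ?j c" by (simp only:)
    then show ?thesis by (simp only: comp_apply)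
  qed
  have "?j ` carrier (homology_group k K) \<subseteq> (?j \<circ> ?p) ` carrier (homology_group k X)"
  proof
    fix b assume "b \<in> ?j ` carrier (homology_group k K)"
    then obtain c where "b = (?j \<circ> ?p) (?q (?j c))" using jpqj_eq by auto
    then show "b \<in> (?j \<circ> ?p) ` carrier (homology_group k X)"
      using hom_induced_carrier by blast
  qed
  moreover have "(?j \<circ> ?p) ` carrier (homology_group k X) \<subseteq> ?j ` carrier (homology_group k K)"
    using hom_induced_carrier by fastforce
  ultimately have im: "(?j \<circ> ?p) ` carrier (homology_group k X) = ?j ` carrier (homology_group k K)"
    by blast
  have "?j \<circ> ?p \<in> hom (homology_group k X) (homology_group k L)"
    by (rule Group.hom_compose[OF hom_induced_empty_hom hom_induced_empty_hom])
  then have "?j \<circ> ?p \<in> iso (homology_group k X) (hom_image (homology_group k K) (homology_group k L) ?j)"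
    using inj im hom_induced_carrier[of k X "{}" K "{}" p]
    by (simp add: iso_iff hom_image_def hom_def image_comp Pi_iff)
  then show ?thesis by (rule is_isoI)
qed

section \<open>The maps between \<open>X\<close> and the Rips complexes, and the two
  homotopies\<close>

context convex_subspace
begin

theorem homology_iso_rips_image:
  fixes S :: "'a set"
  assumes S: "finite S" and \<epsilon>: "0 < \<epsilon>"
    and near_S: "\<And>x. x \<in> X \<Longrightarrow> \<exists>s\<in>S. dist x s < \<epsilon> / 4"
    and near_X: "\<And>s. s \<in> S \<Longrightarrow> \<exists>x\<in>X. dist x s < \<epsilon> / 4"
    and small: "D * (3 * D + 2) * \<epsilon> / 2 < r"
  defines "\<alpha> \<equiv> (1 / 2) * (3 * D + 1) * \<epsilon>"
  shows "homology_group (int k) (top_of_set X) \<cong>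
    hom_image (complex_homology k (rips_complex \<epsilon> S)) (complex_homology k (rips_complex \<alpha> S))
      (complex_hom_induced k (rips_complex \<epsilon> S) (rips_complex \<alpha> S) (\<lambda>s. s))"
proof -
  \<comment> \<open>This is \<open>D * (\<alpha> + \<epsilon> / 2)\<close>, the bound on length
    distances between the points \<open>g s\<close> for \<open>s\<close> in one simplex of the
    larger complex.\<close>
  define \<Delta> where "\<Delta> = D * (3 * D + 2) * \<epsilon> / 2"
  have \<Delta>: "\<Delta> < r" using small by (simp add: \<Delta>_def)
  have \<alpha>: "\<epsilon> / 2 \<le> \<alpha>" using D_nonneg \<epsilon> by (simp add: \<alpha>_def)
  obtain g where g: "\<And>s. s \<in> S \<Longrightarrow> g s \<in> X" "\<And>s. s \<in> S \<Longrightarrow> dist (g s) s < \<epsilon> / 4"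
    using near_X by metis
  let ?P = "nearby_weights S (\<epsilon> / 4)"
  let ?K = "\<Union>\<sigma>\<in>rips_complex \<epsilon> S. closed_simplex \<sigma>"
  let ?L = "\<Union>\<sigma>\<in>rips_complex \<alpha> S. closed_simplex \<sigma>"

  have g_dist: "dist (g u) (g v) \<le> dist u v + \<epsilon> / 2" if "u \<in> S" "v \<in> S" for u v
    using g(2)[OF that(1)] g(2)[OF that(2)] dist_triangle[of "g u" "g v" u]
      dist_triangle[of u "g v" v] dist_commute[of v "g v"] by linarith
  have g_d: "d (g u) (g v) \<le> D * (b + \<epsilon> / 2)" if "u \<in> S" "v \<in> S" "dist u v \<le> b" for u v b
    using d_le[OF g(1)[OF that(1)] g(1)[OF that(2)]] g_dist[OF that(1,2)] that(3) D_nonneg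
    by (smt (verit) mult_left_mono)

  \<comment> \<open>For small \<open>D\<close>, as for a one-point \<open>X\<close> of distortion 0,
    \<open>\<epsilon> \<le> \<alpha>\<close> fails. So edges are estimated through
    \<open>g u\<close> and \<open>g v\<close>, using that the Euclidean distance is at most the
    length distance.\<close>
  have KL: "\<sigma> \<in> rips_complex \<alpha> S" if "\<sigma> \<in> rips_complex \<epsilon> S" for \<sigma>
  proof -
    have "dist u v \<le> \<alpha>" if uv: "u \<in> S" "v \<in> S" "dist u v \<le> \<epsilon>" for u v
    proof -
      have "dist u v \<le> dist (g u) (g v) + \<epsilon> / 2"
        using g(2)[OF uv(1)] g(2)[OF uv(2)] dist_triangle[of u v "g u"]
          dist_triangle[of "g u" v "g v"] dist_commute[of u "g u"] by linarith
      also have "dist (g u) (g v) \<le> D * (\<epsilon> + \<epsilon> / 2)"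
        using dist_le_d[OF g(1)[OF uv(1)] g(1)[OF uv(2)]] g_d[OF uv] by simp
      finally show ?thesis by (simp add: \<alpha>_def algebra_simps)
    qed
    then show ?thesis using that by (simp add: rips_complex_iff) (metis subsetD)
  qed
  have close: "d (g u) (g v) \<le> \<Delta>" if "\<sigma> \<in> rips_complex \<alpha> S" "u \<in> \<sigma>" "v \<in> \<sigma>" for \<sigma> u v
  proof -
    have "d (g u) (g v) \<le> D * (\<alpha> + \<epsilon> / 2)"
      using that by (intro g_d) (auto simp: rips_complex_iff)
    also have "\<dots> = \<Delta>" by (simp add: \<Delta>_def \<alpha>_def algebra_simps)
    finally show ?thesis .
  qed
  have near_simplex: "{s \<in> S. dist x s < \<epsilon> / 4} \<in> rips_complex \<epsilon> S" if "x \<in> X" for x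
  proof -
    have "dist u v \<le> \<epsilon>" if "dist x u < \<epsilon> / 4" "dist x v < \<epsilon> / 4" for u v
      using that dist_triangle[of u v x] dist_commute[of u x] \<epsilon> by linarith
    then show ?thesis using S near_S[OF that] by (auto simp: rips_complex_iff)
  qed

  \<comment> \<open>One enumeration of all of \<open>S\<close> serves every simplex, so
    \<open>q\<close> is a single formula and no agreement on common faces has to be checked.\<close>
  obtain vs where vs: "distinct vs" "set vs = S"
    using S finite_distinct_list by blast
  have total: "0 < sum_list (map p vs)" if "p \<in> closed_simplex \<sigma>" "\<sigma> \<in> rips_complex \<alpha> S" for p \<sigma>
  proof -
    have "p \<in> closed_simplex S"
      using that closed_simplex_mono[of \<sigma> S] S by (auto simp: rips_complex_iff)
    then show ?thesis
      using vs by (simp add: closed_simplex_def sum_list_distinct_conv_sum_set)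
  qed
  define q where "q = geodesic_simplex g vs"
  have q_hull: "q p \<in> X"
    "\<And>z E. z \<in> X \<Longrightarrow> E < r \<Longrightarrow> (\<And>v. v \<in> \<sigma> \<Longrightarrow> d (g v) z \<le> E) \<Longrightarrow> d (q p) z \<le> E"
    if "\<sigma> \<in> rips_complex \<alpha> S" "p \<in> closed_simplex \<sigma>" for \<sigma> p
  proof -
    have "\<sigma> \<subseteq> S" using that by (auto simp: rips_complex_iff)
    then have "q p \<in> X \<and> (\<forall>z\<in>X. \<forall>E<r. (\<forall>v\<in>\<sigma>. d (g v) z \<le> E) \<longrightarrow> d (q p) z \<le> E)"
      unfolding q_def using that total close g \<Delta>
      by (intro geodesic_simplex_hull[where \<Delta> = \<Delta>]) auto
    then show "q p \<in> X"
      "\<And>z E. z \<in> X \<Longrightarrow> E < r \<Longrightarrow> (\<And>v. v \<in> \<sigma> \<Longrightarrow> d (g v) z \<le> E) \<Longrightarrow> d (q p) z \<le> E"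
      by blast+
  qed
  have q_cont: "continuous_on ?L q"
  proof (rule continuous_on_closed_Union)
    show "finite (rips_complex \<alpha> S)" using S by (rule finite_rips_complex)
    show "closed (closed_simplex \<sigma>)" for \<sigma> :: "'a set" by (rule closed_closed_simplex)
    fix \<sigma> assume \<sigma>: "\<sigma> \<in> rips_complex \<alpha> S"
    then have "{p \<in> closed_simplex \<sigma>. 0 < sum_list (map p vs)} = closed_simplex \<sigma>" and "\<sigma> \<subseteq> S"
      using total by (auto simp: rips_complex_iff)
    then show "continuous_on (closed_simplex \<sigma>) q"
      using continuous_on_geodesic_simplex[of \<sigma> g \<Delta> vs] close[OF \<sigma>] g(1) \<Delta>
      by (simp add: q_def subset_iff)
  qed
  have P_simplex: "?P x \<in> closed_simplex {s \<in> S. dist x s < \<epsilon> / 4}" if "x \<in> X" for x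
    using nearby_weights_in_simplex S near_S[OF that] by blast
  have P_cont: "continuous_on X ?P"
    using S near_S by (rule continuous_on_nearby_weights)

  have "homotopic_with (\<lambda>h. True) (top_of_set X) (top_of_set X) (q \<circ> (\<lambda>p. p) \<circ> ?P) id"
  proof -
    \<comment> \<open>The carrier of \<open>?P x\<close> consists of points within
      \<open>\<epsilon> / 4\<close> of \<open>x\<close>, so their images under \<open>g\<close> are
      within \<open>\<epsilon> / 2\<close> of \<open>x\<close>, and the hull estimate
      applies.\<close>
    have qP: "q (?P x) \<in> X" "d (q (?P x)) x < r" if x: "x \<in> X" for x
    proof -
      note \<sigma> = KL[OF near_simplex[OF x]] and Px = P_simplex[OF x]
      show "q (?P x) \<in> X" using q_hull(1)[OF \<sigma> Px] .
      have le: "D * (\<epsilon> / 2) \<le> \<Delta>"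
        using D_nonneg \<epsilon> by (simp add: \<Delta>_def mult_le_cancel_left algebra_simps)
      have "d (q (?P x)) x \<le> D * (\<epsilon> / 2)"
      proof (rule q_hull(2)[OF \<sigma> Px x])
        show "D * (\<epsilon> / 2) < r" using le \<Delta> by simp
        fix v assume "v \<in> {s \<in> S. dist x s < \<epsilon> / 4}"
        then have v: "v \<in> S" "dist x v < \<epsilon> / 4" by auto
        have "dist (g v) x \<le> \<epsilon> / 2"
          using g(2)[OF v(1)] v(2) dist_triangle[of "g v" x v] dist_commute[of v x] by linarith
        then show "d (g v) x \<le> D * (\<epsilon> / 2)"
          using d_le[OF g(1)[OF v(1)] x] D_nonneg by (meson mult_left_mono order_trans)
      qed
      then show "d (q (?P x)) x < r" using le \<Delta> by simp
    qed
    have "continuous_on X (\<lambda>x. q (?P x))"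
      by (rule continuous_on_compose2[OF q_cont P_cont]) (use P_simplex KL near_simplex in blast)
    then have "continuous_on ({0..1::real} \<times> X) (\<lambda>z. q (?P (snd z)))"
      by (rule continuous_on_compose2) (auto intro: continuous_on_snd[OF continuous_on_id])
    then have "continuous_on ({0..1} \<times> X) (\<lambda>z. geodesic_point (q (?P (snd z))) (snd z) (fst z))"
      by (rule continuous_on_geodesic_point[OF _ continuous_on_snd[OF continuous_on_id]
            continuous_on_fst[OF continuous_on_id]]) (use qP in auto)
    then show ?thesis
      by (rule homotopic_with_top_of_setI) (use qP in \<open>auto intro: geodesic_point_in\<close>)
  qed
  moreover have "homotopic_with (\<lambda>h. True) (top_of_set ?K) (top_of_set ?L) ((\<lambda>p. p) \<circ> ?P \<circ> q \<circ> (\<lambda>p. p)) (\<lambda>p. p)"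
  proof -
    let ?h = "\<lambda>z s. (1 - fst z) * ?P (q (snd z)) s + fst z * snd z s"
    have h_in: "?h (t, p) \<in> ?L" if t: "t \<in> {0..1}" and p: "p \<in> ?K" for t p
    proof -
      obtain \<sigma> where \<sigma>: "\<sigma> \<in> rips_complex \<epsilon> S" and p\<sigma>: "p \<in> closed_simplex \<sigma>" using p by blast
      note hull = q_hull[OF KL[OF \<sigma>] p\<sigma>]
      define \<tau> where "\<tau> = {s \<in> S. dist (q p) s < \<epsilon> / 4}"
      have \<sigma>S: "\<sigma> \<subseteq> S" "finite \<sigma>" and \<tau>S: "finite \<tau>" "\<tau> \<subseteq> S"
        using \<sigma> S by (auto simp: rips_complex_iff \<tau>_def)
      have g_near: "dist (g s) (q p) \<le> D * (\<epsilon> + \<epsilon> / 2)" if s: "s \<in> \<sigma>" for s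
      proof -
        \<comment> \<open>The hull estimate needs a bound below \<open>r\<close>. For
          \<open>0 < D < 1/3\<close> the first term exceeds \<open>\<Delta>\<close>, so the minimum
          is taken.\<close>
        have "d (q p) (g s) \<le> min (D * (\<epsilon> + \<epsilon> / 2)) \<Delta>"
        proof (rule hull(2))
          fix v assume "v \<in> \<sigma>"
          then show "d (g v) (g s) \<le> min (D * (\<epsilon> + \<epsilon> / 2)) \<Delta>"
            using close[OF KL[OF \<sigma>]] \<sigma> \<sigma>S s by (intro min.boundedI g_d) (auto simp: rips_complex_iff)
        qed (use s \<sigma>S g \<Delta> in auto)
        moreover have "dist (q p) (g s) \<le> d (q p) (g s)"
          using s \<sigma>S g hull(1) by (intro dist_le_d) auto
        ultimately show ?thesis by (simp add: dist_commute)
      qed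
      \<comment> \<open>The chain \<open>s\<close>, \<open>g s\<close>, \<open>q p\<close>,
        \<open>s'\<close> gives
        \<open>\<epsilon> / 4 + 3 * D * \<epsilon> / 2 + \<epsilon> / 4\<close>, which is exactly
        \<open>\<alpha>\<close>.\<close>
      have cross: "dist s s' \<le> \<alpha>" if "s \<in> \<sigma>" "s' \<in> \<tau>" for s s'
      proof -
        have "dist (g s) s < \<epsilon> / 4" "dist (q p) s' < \<epsilon> / 4"
          using that \<sigma>S g by (auto simp: \<tau>_def)
        then have "dist s s' \<le> D * (\<epsilon> + \<epsilon> / 2) + \<epsilon> / 2"
          using g_near[OF that(1)] dist_triangle[of s s' "g s"] dist_triangle[of "g s" s' "q p"]
            dist_commute[of s "g s"] by linarith
        then show ?thesis by (simp add: \<alpha>_def algebra_simps)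
      qed
      have "dist s s' \<le> \<alpha>" if "s \<in> \<tau>" "s' \<in> \<tau>" for s s'
        using that dist_triangle[of s s' "q p"] dist_commute[of s "q p"] \<alpha> unfolding \<tau>_def by auto
      then have "\<sigma> \<union> \<tau> \<in> rips_complex \<alpha> S"
        using KL[OF \<sigma>] cross \<tau>S by (auto simp: rips_complex_iff) (metis dist_commute)
      moreover have "?P (q p) \<in> closed_simplex (\<sigma> \<union> \<tau>)" "p \<in> closed_simplex (\<sigma> \<union> \<tau>)"
        using P_simplex[OF hull(1), folded \<tau>_def] p\<sigma> closed_simplex_mono[of \<tau> "\<sigma> \<union> \<tau>"] closed_simplex_mono[of \<sigma> "\<sigma> \<union> \<tau>"]
          \<sigma>S \<tau>S by auto
      ultimately show ?thesis
        using closed_simplex_convex_combination[of "?P (q p)" "\<sigma> \<union> \<tau>" p t] t by auto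
    qed
    have KL': "?K \<subseteq> ?L" using KL by blast
    have Pq: "continuous_on ?K (\<lambda>p. ?P (q p))"
      by (rule continuous_on_compose2[OF P_cont continuous_on_subset[OF q_cont KL']])
        (use q_hull(1) KL in blast)
    have "continuous_on ({0..1} \<times> ?K) (\<lambda>z. ?P (q (snd z)))"
      by (rule continuous_on_compose2[OF Pq continuous_on_snd[OF continuous_on_id]]) auto
    then have Pq_coord: "continuous_on ({0..1} \<times> ?K) (\<lambda>z. ?P (q (snd z)) s)" for s
      by (rule continuous_on_product_then_coordinatewise)
    have snd_coord: "continuous_on ({0..1::real} \<times> ?K) (\<lambda>z. snd z s)" for s
      by (rule continuous_on_product_then_coordinatewise[OF continuous_on_snd[OF continuous_on_id]])
    have "continuous_on ({0..1} \<times> ?K) ?h"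
      by (intro continuous_on_coordinatewise_then_product continuous_intros Pq_coord snd_coord)
    then show ?thesis
      by (rule homotopic_with_top_of_setI) (use h_in in auto)
  qed
  moreover have "continuous_map (top_of_set X) (top_of_set ?K) ?P"
    using P_cont P_simplex near_simplex by auto
  moreover have "continuous_map (top_of_set ?K) (top_of_set ?L) (\<lambda>p. p)"
    using KL by (auto intro: continuous_intros)
  moreover have "continuous_map (top_of_set ?L) (top_of_set X) q"
    using q_cont q_hull(1) by auto
  ultimately show ?thesis
    unfolding complex_homology_def complex_hom_induced_def realization_map_id
      realization_eq_top_of_set[OF finite_rips_complex[OF S]]
    by (rule_tac homology_iso_hom_image)
qed

end

section \<open>From extended-real hypotheses to real constants\<close>

lemma length_dist_le_distortion:
  assumes "geodesic_subspace X" "distortion X < \<infinity>" "x \<in> X" "y \<in> X"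
  shows "length_dist X x y \<le> ennreal (enn2real (distortion X) * dist x y)"
proof (cases "x = y")
  case True
  then show ?thesis using assms by (simp add: length_dist_refl)
next
  case False
  have "length_dist X x y / ennreal (dist x y) \<le> distortion X"
    unfolding distortion_def using assms False by (intro SUP_upper2[of "(x, y)"]) auto
  also have "distortion X = ennreal (enn2real (distortion X))"
    using assms(2) by simp
  finally have le: "length_dist X x y / ennreal (dist x y) \<le> ennreal (enn2real (distortion X))" .
  have "length_dist X x y < \<infinity>"
    using assms unfolding geodesic_subspace_def by metis
  then obtain l where l: "0 \<le> l" "length_dist X x y = ennreal l"
    by (cases "length_dist X x y") auto
  show ?thesis
    using le l False by (simp add: divide_ennreal divide_le_eq)
qed

lemma convexity_radius_greater:
  assumes "ennreal c < convexity_radius X" "0 \<le> c"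
  obtains r where "c < r" "unique_geodesics_within X r" "convex_distances_within X r"
    "contracting_geodesics_within X r"
  using assms unfolding convexity_radius_def less_Sup_iff by (auto simp: ennreal_less_iff)

lemma hausdorff_distance_lessD:
  assumes "hausdorff_distance A B < ennreal e"
  shows "x \<in> A \<Longrightarrow> \<exists>y\<in>B. dist x y < e" "y \<in> B \<Longrightarrow> \<exists>x\<in>A. dist x y < e"
proof -
  have 1: "(SUP x\<in>A. INF y\<in>B. ennreal (dist x y)) < ennreal e"
    and 2: "(SUP y\<in>B. INF x\<in>A. ennreal (dist x y)) < ennreal e"
    using assms by (auto simp: hausdorff_distance_def)
  show "\<exists>y\<in>B. dist x y < e" if "x \<in> A"
    using le_less_trans[OF SUP_upper[OF that] 1] by (auto simp: INF_less_iff ennreal_less_iff)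
  show "\<exists>x\<in>A. dist x y < e" if "y \<in> B"
    using le_less_trans[OF SUP_upper[OF that] 2] by (auto simp: INF_less_iff ennreal_less_iff)
qed

theorem mainTheorem1:
  fixes X S :: "(real ^ 'n) set" and \<epsilon> :: real and \<delta> \<rho> :: ennreal and k :: nat
  assumes "geodesic_subspace X"
    and "\<rho> = convexity_radius X" and "0 < \<rho>"
    and "\<delta> = distortion X" and "\<delta> < \<infinity>"
    and "finite S"
    and "0 < \<epsilon>"
    and "hausdorff_distance X S < ennreal (\<epsilon> / 4)"
    and "ennreal (\<epsilon> / 4) < \<rho> / (2 * \<delta> * (3 * \<delta> + 2))"
  shows "homology_group (int k) (top_of_set X) \<cong>
    hom_image
      (complex_homology k (rips_complex \<epsilon> S))
      (complex_homology k (rips_complex ((1 / 2) * (3 * enn2real \<delta> + 1) * \<epsilon>) S))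
      (complex_hom_induced k (rips_complex \<epsilon> S)
         (rips_complex ((1 / 2) * (3 * enn2real \<delta> + 1) * \<epsilon>) S) (\<lambda>s. s))"
proof -
  define D where "D = enn2real \<delta>"
  have D: "0 \<le> D" "\<delta> = ennreal D" using assms(5) by (auto simp: D_def)
  have "ennreal (D * (3 * D + 2) * \<epsilon> / 2) < convexity_radius X"
  \<comment> \<open>For \<open>D = 0\<close> the bound on \<open>\<epsilon>\<close> divides by zero
    and its right side is infinite, but then the claim is just positivity of the convexity
    radius.\<close>
  proof (cases "D = 0")
    case True
    then show ?thesis using assms(2,3) by simp
  next
    case False
    have "2 * \<delta> * (3 * \<delta> + 2) = ennreal (2 * D * (3 * D + 2))"
      using D(1) unfolding D(2) by (simp add: ennreal_mult ennreal_plus)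
    moreover have "0 < 2 * D * (3 * D + 2)" using D False by simp
    moreover have "0 \<le> D * (\<epsilon> * (3 * D + 2)) / 2" using D assms(7) by simp
    \<comment> \<open>The positive finite denominator is multiplied out; the cases separate finite
      from infinite \<open>\<rho>\<close>.\<close>
    ultimately have "ennreal (\<epsilon> / 4 * (2 * D * (3 * D + 2))) < \<rho>"
      using assms(9) by (cases \<rho>)
        (auto simp: divide_ennreal ennreal_less_iff less_divide_eq assms(7) less_imp_le)
    also have "\<epsilon> / 4 * (2 * D * (3 * D + 2)) = D * (3 * D + 2) * \<epsilon> / 2" by simp
    finally show ?thesis using assms(2) by simp
  qed
  moreover have "0 \<le> D * (3 * D + 2) * \<epsilon> / 2" using D assms(7) by simp
  ultimately obtain r where r: "D * (3 * D + 2) * \<epsilon> / 2 < r"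
    and within: "unique_geodesics_within X r" "convex_distances_within X r" "contracting_geodesics_within X r"
    by (rule convexity_radius_greater)
  have "length_dist X x y \<le> ennreal (D * dist x y)" if "x \<in> X" "y \<in> X" for x y
    using length_dist_le_distortion[OF assms(1) _ that] assms(4,5) unfolding D_def by simp
  then interpret convex_subspace X r D
    using assms(1) D(1) within by unfold_locales
  show ?thesis
    unfolding D_def[symmetric]
    by (rule homology_iso_rips_image[OF assms(6,7) _ _ r]) (use hausdorff_distance_lessD[OF assms(8)] in auto)
qed

end
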